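(* For every $\epsilon>0$ there exists an infinite, finitely generated, residually finite group $G$ such that, with $G$ equipped with the basic measure, $\alpha(G)<\epsilon$.
   Context: The basic measure on a group $G$ is defined as follows. Let $\mathcal{B}$ be the collection consisting of $\emptyset$ and all finite unions of left and right cosets of finite index subgroups of $G$ (the measurable subsets). Each $A\in\mathcal{B}$ is a union of some number $r$ of cosets of a finite index normal subgroup $R$ of $G$, and $|A|=r/[G:R]$ (this is well defined, finitely additive, and $|G|=1$). A subset $S$ of $G$ is product free if $S\cap S^2=\emptyset$, where $S^2=\{st:s,t\in S\}$. $\alpha(G)$ is the supremum of $|S|$ over all measurable product free subsets $S$ of $G$. *)

theory Defs
  imports Complex_Main "HOL-Algebra.Coset" "HOL-Algebra.Generated_Groups"
begin

section \<open>Finitely generated and residually finite groups\<close>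

definition finite_index_subgroup :: "'a set \<Rightarrow> ('a, 'b) monoid_scheme \<Rightarrow> bool" where
  "finite_index_subgroup H G \<longleftrightarrow> subgroup H G \<and> finite (rcosets\<^bsub>G\<^esub> H)"

definition finite_index_normal :: "'a set \<Rightarrow> ('a, 'b) monoid_scheme \<Rightarrow> bool" where
  "finite_index_normal R G \<longleftrightarrow> R \<lhd> G \<and> finite (rcosets\<^bsub>G\<^esub> R)"

definition finitely_generated :: "('a, 'b) monoid_scheme \<Rightarrow> bool" where
  "finitely_generated G \<longleftrightarrow>
     (\<exists>X. finite X \<and> X \<subseteq> carrier G \<and> generate G X = carrier G)"

definition residually_finite :: "('a, 'b) monoid_scheme \<Rightarrow> bool" where
  "residually_finite G \<longleftrightarrow>
     (\<forall>g \<in> carrier G. g \<noteq> \<one>\<^bsub>G\<^esub> \<longrightarrow> (\<exists>R. finite_index_normal R G \<and> g \<notin> R))"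


section \<open>The basic measure\<close>

definition finite_index_coset :: "('a, 'b) monoid_scheme \<Rightarrow> 'a set \<Rightarrow> bool" where
  "finite_index_coset G C \<longleftrightarrow>
     (\<exists>H x. finite_index_subgroup H G \<and> x \<in> carrier G \<and>
            (C = H #>\<^bsub>G\<^esub> x \<or> C = x <#\<^bsub>G\<^esub> H))"

text \<open>The empty set is included as the union of the empty family.\<close>

definition measurable_subsets :: "('a, 'b) monoid_scheme \<Rightarrow> 'a set set" where
  "measurable_subsets G = {\<Union>F | F. finite F \<and> (\<forall>C \<in> F. finite_index_coset G C)}"

text \<open>The description below has exactly one value on each measurable set; existence and
  uniqueness are proved as \<open>measurable_imp_union_cosets\<close> and \<open>basic_measure_eqI\<close>.\<close>

definition basic_measure :: "('a, 'b) monoid_scheme \<Rightarrow> 'a set \<Rightarrow> real" where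
  "basic_measure G A =
     (THE m. \<exists>R D. finite_index_normal R G \<and> D \<subseteq> rcosets\<^bsub>G\<^esub> R \<and> A = \<Union>D \<and>
                   m = real (card D) / real (card (rcosets\<^bsub>G\<^esub> R)))"

definition product_free :: "('a, 'b) monoid_scheme \<Rightarrow> 'a set \<Rightarrow> bool" where
  "product_free G S \<longleftrightarrow> S \<inter> (S <#>\<^bsub>G\<^esub> S) = {}"

text \<open>The supremum is taken over a nonempty subset of \<open>[0,1]\<close>, see
  \<open>measurable_product_free_values\<close>.\<close>

definition alpha :: "('a, 'b) monoid_scheme \<Rightarrow> real" where
  "alpha G = Sup {basic_measure G S | S. S \<in> measurable_subsets G \<and> product_free G S}"


section \<open>Well-definedness of the basic measure\<close>

context group
begin

lemma rcosets_Int_eq: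
  assumes "subgroup H G" "subgroup K G" "x \<in> carrier G"
  shows "(H \<inter> K) #> x = (H #> x) \<inter> (K #> x)"
proof -
  have "h \<in> H \<inter> K" if "h \<in> H" "k \<in> K" "h \<otimes> x = k \<otimes> x" for h k
    using that assms by (metis IntI right_cancel subgroup.mem_carrier)
  then show ?thesis unfolding r_coset_def by auto
qed

lemma finite_index_Int:
  assumes "subgroup H G" "subgroup K G" "finite (rcosets H)" "finite (rcosets K)"
  shows "finite (rcosets (H \<inter> K))"
proof (rule finite_subset)
  show "rcosets (H \<inter> K) \<subseteq> (\<lambda>(X, Y). X \<inter> Y) ` ((rcosets H) \<times> (rcosets K))"
    unfolding RCOSETS_def using rcosets_Int_eq[OF assms(1,2)] by fastforce
  show "finite ((\<lambda>(X, Y). X \<inter> Y) ` ((rcosets H) \<times> (rcosets K)))"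
    using assms by simp
qed

lemma rcosets_within_rcoset:
  assumes H: "subgroup H G" and K: "subgroup K G" "K \<subseteq> H" and g: "g \<in> carrier G"
  shows "card {X \<in> rcosets K. X \<subseteq> H #> g} = card {X \<in> rcosets K. X \<subseteq> H}"
proof -
  have Hc: "H \<subseteq> carrier G" and Kc: "K \<subseteq> carrier G"
    using H K subgroup.subset by auto
  have sub: "X \<subseteq> carrier G" if "X \<in> rcosets K" for X
    using that rcosets_part_G[OF K(1)] by blast
  have tr: "X #> x \<in> rcosets K" if "X \<in> rcosets K" "x \<in> carrier G" for X x
    using that Kc by (auto simp: RCOSETS_def coset_mult_assoc)
  have mono: "X #> x \<subseteq> Y #> x" if "X \<subseteq> Y" for X Y x
    using that by (auto simp: r_coset_def)
  have "bij_betw (\<lambda>X. X #> g) {X \<in> rcosets K. X \<subseteq> H} {X \<in> rcosets K. X \<subseteq> H #> g}"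
  proof (rule bij_betw_byWitness[where f' = "\<lambda>X. X #> inv g"])
    show "\<forall>X \<in> {X \<in> rcosets K. X \<subseteq> H}. X #> g #> inv g = X"
      using sub g by (simp add: coset_mult_assoc)
    show "\<forall>X \<in> {X \<in> rcosets K. X \<subseteq> H #> g}. X #> inv g #> g = X"
      using sub g by (simp add: coset_mult_assoc)
    show "(\<lambda>X. X #> g) ` {X \<in> rcosets K. X \<subseteq> H} \<subseteq> {X \<in> rcosets K. X \<subseteq> H #> g}"
    proof (rule image_subsetI)
      fix X assume "X \<in> {X \<in> rcosets K. X \<subseteq> H}"
      then show "X #> g \<in> {X \<in> rcosets K. X \<subseteq> H #> g}" using tr g mono[of X H] by blast
    qed
    have "X #> inv g \<subseteq> H" if "X \<subseteq> H #> g" for X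
      using mono[OF that, of "inv g"] g Hc by (simp add: coset_mult_assoc)
    then show "(\<lambda>X. X #> inv g) ` {X \<in> rcosets K. X \<subseteq> H #> g} \<subseteq> {X \<in> rcosets K. X \<subseteq> H}"
      using tr g by auto
  qed
  then show ?thesis by (simp add: bij_betw_same_card)
qed

lemma card_refine:
  assumes H: "subgroup H G" and K: "subgroup K G" "K \<subseteq> H"
    and fin: "finite (rcosets H)" "finite (rcosets K)" and D: "D \<subseteq> rcosets H"
  shows "card {X \<in> rcosets K. X \<subseteq> \<Union>D} = card D * card {X \<in> rcosets K. X \<subseteq> H}"
proof -
  have in_one: "\<exists>Y \<in> D. X \<subseteq> Y" if X: "X \<in> rcosets K" "X \<subseteq> \<Union>D" for X
  proof -
    obtain x where x: "x \<in> carrier G" "X = K #> x"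
      using X by (auto simp: RCOSETS_def)
    then have "x \<in> X" using rcos_self K by blast
    then obtain Y where Y: "Y \<in> D" "x \<in> Y" using X by blast
    then obtain y where y: "y \<in> carrier G" "Y = H #> y"
      using D by (auto simp: RCOSETS_def)
    then have "Y = H #> x" using Y repr_independence[OF _ _ H] by blast
    then have "X \<subseteq> Y" using x K(2) by (auto simp: r_coset_def)
    then show ?thesis using Y by blast
  qed
  have ne: "X \<noteq> {}" if "X \<in> rcosets K" for X
    using that subgroup.rcosets_non_empty[OF K(1)] by blast
  have "{X \<in> rcosets K. X \<subseteq> \<Union>D} = (\<Union>Y \<in> D. {X \<in> rcosets K. X \<subseteq> Y})"
    using in_one by blast
  also have "card \<dots> = (\<Sum>Y \<in> D. card {X \<in> rcosets K. X \<subseteq> Y})"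
  proof (rule card_UN_disjoint)
    show "finite D" using D fin finite_subset by blast
    show "\<forall>Y \<in> D. finite {X \<in> rcosets K. X \<subseteq> Y}" using fin by simp
    have disj: "Y \<inter> Z = {}" if "Y \<in> D" "Z \<in> D" "Y \<noteq> Z" for Y Z
      using rcos_disjoint[OF H] that D unfolding pairwise_def disjnt_def by blast
    show "\<forall>Y \<in> D. \<forall>Z \<in> D. Y \<noteq> Z \<longrightarrow>
        {X \<in> rcosets K. X \<subseteq> Y} \<inter> {X \<in> rcosets K. X \<subseteq> Z} = {}"
    proof (intro ballI impI)
      fix Y Z assume YZ: "Y \<in> D" "Z \<in> D" "Y \<noteq> Z"
      have "Y \<inter> Z = {}" using disj[OF YZ] .
      then have "X = {}" if "X \<subseteq> Y" "X \<subseteq> Z" for X using that by auto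
      then show "{X \<in> rcosets K. X \<subseteq> Y} \<inter> {X \<in> rcosets K. X \<subseteq> Z} = {}"
        using ne by auto
    qed
  qed
  also have "\<dots> = (\<Sum>Y \<in> D. card {X \<in> rcosets K. X \<subseteq> H})"
  proof (rule sum.cong[OF refl])
    fix Y assume "Y \<in> D"
    then obtain y where "y \<in> carrier G" "Y = H #> y"
      using D by (auto simp: RCOSETS_def)
    then show "card {X \<in> rcosets K. X \<subseteq> Y} = card {X \<in> rcosets K. X \<subseteq> H}"
      using rcosets_within_rcoset[OF H K] by simp
  qed
  finally show ?thesis by simp
qed

lemma ratio_refine:
  assumes H: "subgroup H G" and K: "subgroup K G" "K \<subseteq> H"
    and fin: "finite (rcosets H)" "finite (rcosets K)" and D: "D \<subseteq> rcosets H"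
  shows "real (card D) / real (card (rcosets H)) =
         real (card {X \<in> rcosets K. X \<subseteq> \<Union>D}) / real (card (rcosets K))"
proof -
  let ?k = "card {X \<in> rcosets K. X \<subseteq> H}"
  have "K \<in> rcosets K" using subgroup.subgroup_in_rcosets[OF K(1)] is_group by blast
  then have k: "?k \<noteq> 0" using K(2) fin by auto
  have "{X \<in> rcosets K. X \<subseteq> \<Union>(rcosets H)} = rcosets K"
    using rcosets_part_G[OF H] rcosets_part_G[OF K(1)] by auto
  then have "card (rcosets K) = card (rcosets H) * ?k"
    using card_refine[OF H K fin subset_refl] by simp
  then show ?thesis using k card_refine[OF assms] by simp
qed

lemma ratio_unique:
  assumes "finite_index_normal R G" "D \<subseteq> rcosets R"
    and "finite_index_normal R' G" "D' \<subseteq> rcosets R'" and "\<Union>D = \<Union>D'"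
  shows "real (card D) / real (card (rcosets R)) = real (card D') / real (card (rcosets R'))"
proof -
  have sg: "subgroup R G" "subgroup R' G" and fin: "finite (rcosets R)" "finite (rcosets R')"
    using assms by (auto simp: finite_index_normal_def normal_imp_subgroup)
  have K: "subgroup (R \<inter> R') G" "finite (rcosets (R \<inter> R'))"
    using sg fin finite_index_Int subgroups_Inter_pair by auto
  show ?thesis
    using ratio_refine[OF sg(1) K(1) _ fin(1) K(2) assms(2)]
      ratio_refine[OF sg(2) K(1) _ fin(2) K(2) assms(4)] assms(5) by simp
qed

lemma basic_measure_eqI:
  assumes "finite_index_normal R G" "D \<subseteq> rcosets R" "A = \<Union>D"
  shows "basic_measure G A = real (card D) / real (card (rcosets R))"
  unfolding basic_measure_def
  by (rule the_equality) (use assms ratio_unique in blast)+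

lemma finite_index_normal_core:
  assumes "finite_index_subgroup H G"
  obtains N where "finite_index_normal N G" "N \<subseteq> H"
proof -
  have H: "subgroup H G" and fin: "finite (rcosets H)" and Hc: "H \<subseteq> carrier G"
    using assms subgroup.subset by (auto simp: finite_index_subgroup_def)
  define N where "N = {g \<in> carrier G. \<forall>X \<in> rcosets H. X #> g = X}"
  have sub: "X \<subseteq> carrier G" if "X \<in> rcosets H" for X
    using that rcosets_part_G[OF H] by blast
  have tr: "X #> x \<in> rcosets H" if "X \<in> rcosets H" "x \<in> carrier G" for X x
    using that Hc by (auto simp: RCOSETS_def coset_mult_assoc)
  have Nc: "N \<subseteq> carrier G" by (auto simp: N_def)
  have N: "subgroup N G"
  proof (rule subgroupI)
    show "N \<subseteq> carrier G" by (fact Nc)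
    have "\<one> \<in> N" using sub by (auto simp: N_def)
    then show "N \<noteq> {}" by blast
    show "inv a \<in> N" if "a \<in> N" for a
    proof -
      have a: "a \<in> carrier G" "\<And>X. X \<in> rcosets H \<Longrightarrow> X #> a = X"
        using that by (auto simp: N_def)
      have "X #> inv a = X" if "X \<in> rcosets H" for X
        using a(2)[OF that] sub[OF that] a(1)
        by (metis coset_mult_assoc coset_mult_one inv_closed r_inv)
      then show ?thesis using a(1) by (simp add: N_def)
    qed
    show "a \<otimes> b \<in> N" if "a \<in> N" "b \<in> N" for a b
    proof -
      have "X #> (a \<otimes> b) = X" if X: "X \<in> rcosets H" for X
        using \<open>a \<in> N\<close> \<open>b \<in> N\<close> X sub[OF X] coset_mult_assoc[of X a b]
        by (simp add: N_def)
      then show ?thesis using that by (simp add: N_def)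
    qed
  qed
  have "x \<otimes> h \<otimes> inv x \<in> N" if x: "x \<in> carrier G" and h: "h \<in> N" for x h
  proof -
    have hc: "h \<in> carrier G" using h Nc by blast
    have "X #> (x \<otimes> h \<otimes> inv x) = X" if X: "X \<in> rcosets H" for X
    proof -
      have "X #> (x \<otimes> h \<otimes> inv x) = X #> x #> h #> inv x"
        using sub[OF X] x hc by (simp add: coset_mult_assoc r_coset_subset_G m_assoc)
      also have "\<dots> = X #> x #> inv x"
        using tr[OF X x] h by (simp add: N_def)
      also have "\<dots> = X" using sub[OF X] x by (simp add: coset_mult_assoc)
      finally show ?thesis .
    qed
    then show ?thesis using x hc by (simp add: N_def)
  qed
  then have nor: "N \<lhd> G" using N by (simp add: normal_inv_iff)
  have "N #> x = N #> y"
    if x: "x \<in> carrier G" and y: "y \<in> carrier G"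
      and eq: "restrict (\<lambda>X. X #> x) (rcosets H) = restrict (\<lambda>X. X #> y) (rcosets H)" for x y
  proof -
    have "X #> (x \<otimes> inv y) = X" if X: "X \<in> rcosets H" for X
    proof -
      have "X #> x = X #> y" using fun_cong[OF eq, of X] X by simp
      then show ?thesis using coset_mult_inv2 x y sub[OF X] by blast
    qed
    then have "x \<otimes> inv y \<in> N" using x y by (simp add: N_def)
    then have "x \<in> N #> y"
      using x y by (metis N subgroup.rcos_module is_group)
    then show ?thesis using repr_independence[OF _ y N] by blast
  qed
  then have "finite ((\<lambda>x. N #> x) ` carrier G)"
  proof -
    let ?f = "\<lambda>x. restrict (\<lambda>X. X #> x) (rcosets H)"
    assume *: "\<And>x y. x \<in> carrier G \<Longrightarrow> y \<in> carrier G \<Longrightarrow> ?f x = ?f y \<Longrightarrow> N #> x = N #> y"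
    have "?f ` carrier G \<subseteq> rcosets H \<rightarrow>\<^sub>E rcosets H" using tr by auto
    then have f: "finite (?f ` carrier G)"
      using fin by (meson finite_PiE finite_subset)
    have "(\<lambda>x. N #> x) ` carrier G \<subseteq> (\<lambda>u. N #> inv_into (carrier G) ?f u) ` (?f ` carrier G)"
    proof
      fix Y assume "Y \<in> (\<lambda>x. N #> x) ` carrier G"
      then obtain x where x: "x \<in> carrier G" "Y = N #> x" by blast
      have fx: "?f x \<in> ?f ` carrier G" using x by blast
      have "N #> inv_into (carrier G) ?f (?f x) = N #> x"
        by (rule *[OF inv_into_into[OF fx] x(1) f_inv_into_f[OF fx]])
      then show "Y \<in> (\<lambda>u. N #> inv_into (carrier G) ?f u) ` (?f ` carrier G)"
        using x fx by (metis image_eqI)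
    qed
    then show ?thesis using f finite_subset by blast
  qed
  moreover have "rcosets N = (\<lambda>x. N #> x) ` carrier G" by (auto simp: RCOSETS_def)
  ultimately have "finite_index_normal N G" using nor by (simp add: finite_index_normal_def)
  moreover have "N \<subseteq> H"
  proof
    fix g assume g: "g \<in> N"
    have "H \<in> rcosets H" using subgroup.subgroup_in_rcosets[OF H] is_group by blast
    then have "H #> g = H" using g by (simp add: N_def)
    then show "g \<in> H" using coset_join1[OF _ _ H] g Nc by blast
  qed
  ultimately show thesis by (rule that)
qed

lemma finite_index_normal_Int:
  assumes "finite_index_normal M G" "finite_index_normal N G"
  shows "finite_index_normal (M \<inter> N) G"
proof -
  have n: "M \<lhd> G" "N \<lhd> G" and fin: "finite (rcosets M)" "finite (rcosets N)"
    using assms by (auto simp: finite_index_normal_def)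
  have sg: "subgroup M G" "subgroup N G" using n by (auto simp: normal_imp_subgroup)
  have "M \<inter> N \<lhd> G"
    using n subgroups_Inter_pair[OF sg] by (auto simp: normal_inv_iff)
  then show ?thesis using finite_index_Int[OF sg fin] by (simp add: finite_index_normal_def)
qed

lemma finite_index_normal_carrier: "finite_index_normal (carrier G) G"
proof -
  have "carrier G \<lhd> G" by (simp add: normal_inv_iff subgroup_self)
  moreover have "rcosets (carrier G) \<subseteq> {carrier G}"
    using coset_join2[OF _ subgroup_self] by (auto simp: RCOSETS_def)
  then have "finite (rcosets (carrier G))" by (rule finite_subset) simp
  ultimately show ?thesis by (simp add: finite_index_normal_def)
qed

lemma finite_index_coset_invariant:
  assumes "finite_index_coset G C"
  shows "C \<subseteq> carrier G \<and>
    (\<exists>N. finite_index_normal N G \<and> (\<forall>n \<in> N. \<forall>a \<in> C. n \<otimes> a \<in> C))"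
proof -
  obtain H x where H: "finite_index_subgroup H G" and x: "x \<in> carrier G"
    and C: "C = H #> x \<or> C = x <# H"
    using assms by (auto simp: finite_index_coset_def)
  have sH: "subgroup H G" using H by (simp add: finite_index_subgroup_def)
  then have Hc: "H \<subseteq> carrier G" by (simp add: subgroup.subset)
  obtain N where N: "finite_index_normal N G" "N \<subseteq> H"
    using finite_index_normal_core[OF H] by blast
  have nor: "N \<lhd> G" using N by (simp add: finite_index_normal_def)
  have "n \<otimes> a \<in> C" if n: "n \<in> N" and a: "a \<in> C" for n a
    using C
  proof
    assume C: "C = H #> x"
    then obtain h where h: "h \<in> H" "a = h \<otimes> x" using a by (auto simp: r_coset_def)
    have "n \<otimes> a = (n \<otimes> h) \<otimes> x" using h x subsetD[OF Hc] subsetD[OF N(2) n] by (simp add: m_assoc)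
    moreover have "n \<otimes> h \<in> H" using subgroup.m_closed[OF sH subsetD[OF N(2) n] h(1)] .
    ultimately show ?thesis using C by (auto simp: r_coset_def)
  next
    assume C: "C = x <# H"
    then obtain h where h: "h \<in> H" "a = x \<otimes> h" using a by (auto simp: l_coset_def)
    have nc: "n \<in> carrier G" and hc: "h \<in> carrier G" using n h N Hc by auto
    have "inv x \<otimes> n \<otimes> x \<in> N" using normal.inv_op_closed1[OF nor x n] .
    then have "inv x \<otimes> n \<otimes> x \<otimes> h \<in> H"
      using subgroup.m_closed[OF sH subsetD[OF N(2)] h(1)] by blast
    moreover have "n \<otimes> a = x \<otimes> (inv x \<otimes> n \<otimes> x \<otimes> h)"
      using h nc hc x by (simp add: m_assoc[symmetric])
    ultimately show ?thesis using C by (auto simp: l_coset_def)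
  qed
  moreover have "C \<subseteq> carrier G"
    using C x Hc by (auto simp: r_coset_def l_coset_def)
  ultimately show ?thesis using N by blast
qed

lemma measurable_imp_union_cosets:
  assumes "A \<in> measurable_subsets G"
  shows "\<exists>R D. finite_index_normal R G \<and> D \<subseteq> rcosets R \<and> A = \<Union>D"
proof -
  obtain F where F: "finite F" "\<forall>C \<in> F. finite_index_coset G C" "A = \<Union>F"
    using assms by (auto simp: measurable_subsets_def)
  have "\<Union>F \<subseteq> carrier G \<and>
      (\<exists>N. finite_index_normal N G \<and> (\<forall>n \<in> N. \<forall>a \<in> \<Union>F. n \<otimes> a \<in> \<Union>F))"
    using F(1,2)
  proof (induction F rule: finite_induct)
    case empty
    show ?case using finite_index_normal_carrier by auto
  next
    case (insert C F)
    obtain M where M: "finite_index_normal M G" "\<forall>n \<in> M. \<forall>a \<in> \<Union>F. n \<otimes> a \<in> \<Union>F"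
      using insert by auto
    obtain N where N: "finite_index_normal N G" "\<forall>n \<in> N. \<forall>a \<in> C. n \<otimes> a \<in> C"
      using insert.prems finite_index_coset_invariant[of C] by auto
    have "finite_index_normal (M \<inter> N) G" using M N by (simp add: finite_index_normal_Int)
    moreover have "\<forall>n \<in> M \<inter> N. \<forall>a \<in> \<Union>(insert C F). n \<otimes> a \<in> \<Union>(insert C F)"
      using M(2) N(2) by auto
    moreover have "\<Union>(insert C F) \<subseteq> carrier G"
      using insert finite_index_coset_invariant[of C] by auto
    ultimately show ?case by blast
  qed
  then obtain N where Ac: "A \<subseteq> carrier G" and N: "finite_index_normal N G"
    and inv: "\<forall>n \<in> N. \<forall>a \<in> A. n \<otimes> a \<in> A"
    using F(3) by blast
  have sN: "subgroup N G" using N by (simp add: finite_index_normal_def normal_imp_subgroup)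
  have "A = \<Union>((\<lambda>a. N #> a) ` A)"
  proof
    show "A \<subseteq> \<Union>((\<lambda>a. N #> a) ` A)" using rcos_self[OF _ sN] Ac by blast
    show "\<Union>((\<lambda>a. N #> a) ` A) \<subseteq> A" using inv by (auto simp: r_coset_def)
  qed
  moreover have "(\<lambda>a. N #> a) ` A \<subseteq> rcosets N" using Ac by (auto simp: RCOSETS_def)
  ultimately show ?thesis using N by blast
qed

lemma basic_measure_carrier: "basic_measure G (carrier G) = 1"
proof -
  let ?R = "carrier G"
  have "basic_measure G (carrier G) = real (card (rcosets ?R)) / real (card (rcosets ?R))"
    using finite_index_normal_carrier
    by (rule basic_measure_eqI) (simp_all add: rcosets_part_G subgroup_self)
  moreover have "?R \<in> rcosets ?R"
    using subgroup.subgroup_in_rcosets[OF subgroup_self] is_group by blast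
  then have "card (rcosets ?R) \<noteq> 0"
    using finite_index_normal_carrier by (auto simp: finite_index_normal_def)
  ultimately show ?thesis by simp
qed

lemma measurable_product_free_values:
  defines "V \<equiv> {basic_measure G S | S. S \<in> measurable_subsets G \<and> product_free G S}"
  shows "V \<subseteq> {0..1}" "0 \<in> V"
proof -
  show "V \<subseteq> {0..1}"
  proof
    fix v assume "v \<in> V"
    then obtain S where S: "S \<in> measurable_subsets G" "v = basic_measure G S"
      by (auto simp: V_def)
    obtain R D where R: "finite_index_normal R G" "D \<subseteq> rcosets R" "S = \<Union>D"
      using measurable_imp_union_cosets[OF S(1)] by blast
    have "card D \<le> card (rcosets R)"
      using R by (simp add: card_mono finite_index_normal_def)
    then show "v \<in> {0..1}"
      using S(2) basic_measure_eqI[OF R] by (auto simp: divide_le_eq_1)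
  qed
  have "basic_measure G {} = 0"
    using basic_measure_eqI[OF finite_index_normal_carrier, of "{}" "{}"] by simp
  moreover have "{} \<in> measurable_subsets G" unfolding measurable_subsets_def by blast
  moreover have "product_free G {}" by (simp add: product_free_def)
  ultimately show "0 \<in> V" unfolding V_def by force
qed

end

end

theory Submission
  imports Defs "HOL-Analysis.Function_Topology" "HOL-Analysis.Convex" "HOL-Algebra.Bij"
begin

text \<open>
  The group is \<open>EL\<^sub>n(F\<^sub>2[x])\<close> for large \<open>n\<close>, generated by the elementary matrices \<open>e\<^sub>i\<^sub>j(1)\<close> and \<open>e\<^sub>i\<^sub>j(x)\<close>.
  It acts faithfully with finite orbits, hence is residually finite.

  In a finite quotient \<open>Q\<close>, Gowers' argument bounds a product-free set \<open>D\<close>. Let \<open>T\<close> be the convolution with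
  (the inverse of) \<open>D\<close> on functions of mean zero, and let \<open>\<lambda>\<close> be the maximum of \<open>\<parallel>T f\<parallel>\<^sup>2\<close> on the unit
  sphere. The maximisers span a subspace invariant under right translations. The first-row matrices
  \<open>e\<^sub>0\<^sub>j(1)\<close> are commuting involutions whose normal closure is everything, so some common eigenvector \<open>w\<close> in
  this subspace has eigenvalue \<open>-1\<close> at some \<open>e\<^sub>0\<^sub>k(1)\<close>; translating \<open>w\<close> by the \<open>e\<^sub>j\<^sub>k(1)\<close> gives \<open>n - 1\<close>
  orthogonal vectors. Since the Hilbert-Schmidt norm of \<open>T\<close> is at most \<open>sqrt (\<bar>Q\<bar> \<bar>D\<bar>)\<close>, it follows that
  \<open>(n - 1) \<lambda> \<le> \<bar>Q\<bar> \<bar>D\<bar>\<close>. Applied to the indicator of \<open>D\<close>, this forces \<open>(n - 1) \<bar>D\<bar>\<^sup>3 \<le> \<bar>Q\<bar>\<^sup>3\<close>.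
\<close>

section \<open>Product-free sets in finite quasirandom groups\<close>

text \<open>If \<open>w\<close> is a common eigenvector of the involutions \<open>t\<close> with \<open>t k w = - w\<close>, then \<open>h j k w\<close> is one
  whose sign at \<open>t j\<close>, and only there, is flipped. Eigenvectors with different signs being
  orthogonal, this yields representations of dimension at least \<open>m\<close>.\<close>

locale flipping_group = group +
  fixes m :: nat and t :: "nat \<Rightarrow> 'a" and h :: "nat \<Rightarrow> nat \<Rightarrow> 'a"
  assumes t_closed: "j < m \<Longrightarrow> t j \<in> carrier G"
    and h_closed: "j < m \<Longrightarrow> k < m \<Longrightarrow> j \<noteq> k \<Longrightarrow> h j k \<in> carrier G"
    and t_square: "j < m \<Longrightarrow> t j \<otimes> t j = \<one>"
    and t_commute: "j < m \<Longrightarrow> k < m \<Longrightarrow> t j \<otimes> t k = t k \<otimes> t j"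
    and t_h_commute: "j < m \<Longrightarrow> k < m \<Longrightarrow> l < m \<Longrightarrow> j \<noteq> k \<Longrightarrow> l \<noteq> j \<Longrightarrow> t l \<otimes> h j k = h j k \<otimes> t l"
    and t_h_flip: "j < m \<Longrightarrow> k < m \<Longrightarrow> j \<noteq> k \<Longrightarrow> t j \<otimes> h j k = h j k \<otimes> (t j \<otimes> t k)"
    and t_normal: "N \<lhd> G \<Longrightarrow> (\<And>j. j < m \<Longrightarrow> t j \<in> N) \<Longrightarrow> N = carrier G"

section \<open>Inner product, right translations and convolution on real functions on a
  group\<close>

context group
begin

definition inner_on :: "('a \<Rightarrow> real) \<Rightarrow> ('a \<Rightarrow> real) \<Rightarrow> real" where
  "inner_on f g = (\<Sum>x\<in>carrier G. f x * g x)"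

definition translate :: "'a \<Rightarrow> ('a \<Rightarrow> real) \<Rightarrow> 'a \<Rightarrow> real" where
  "translate g f = (\<lambda>x. f (x \<otimes> g))"

text \<open>Multiplying by \<open>D\<close> on the left makes the operator commute with right
  translations.\<close>

definition convolve :: "'a set \<Rightarrow> ('a \<Rightarrow> real) \<Rightarrow> 'a \<Rightarrow> real" where
  "convolve D f = (\<lambda>x. \<Sum>y\<in>D. f (y \<otimes> x))"

lemma inner_on_commute: "inner_on f g = inner_on g f"
  by (simp add: inner_on_def mult.commute)

lemma inner_on_add_left: "inner_on (\<lambda>x. f x + g x) k = inner_on f k + inner_on g k"
  by (simp add: inner_on_def algebra_simps sum.distrib)

lemma inner_on_scale_left: "inner_on (\<lambda>x. a * f x) k = a * inner_on f k"
  by (simp add: inner_on_def algebra_simps sum_distrib_left)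

lemma inner_on_scale: "inner_on (\<lambda>x. a * f x) (\<lambda>x. a * f x) = a\<^sup>2 * inner_on f f"
  by (simp add: inner_on_def sum_distrib_left power2_eq_square mult.assoc mult.left_commute)

lemma inner_on_cong:
  "(\<And>x. x \<in> carrier G \<Longrightarrow> f x = f' x) \<Longrightarrow> (\<And>x. x \<in> carrier G \<Longrightarrow> g x = g' x) \<Longrightarrow>
    inner_on f g = inner_on f' g'"
  by (simp add: inner_on_def)

lemma inner_on_nonneg: "inner_on f f \<ge> 0"
  by (simp add: inner_on_def sum_nonneg)

lemma inner_on_eq_0_iff:
  "finite (carrier G) \<Longrightarrow> inner_on f f = 0 \<longleftrightarrow> (\<forall>x\<in>carrier G. f x = 0)"
  by (simp add: inner_on_def sum_nonneg_eq_0_iff)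

lemma bij_betw_mult_right:
  assumes "g \<in> carrier G"
  shows "bij_betw (\<lambda>x. x \<otimes> g) (carrier G) (carrier G)"
  by (rule bij_betw_byWitness[where f' = "\<lambda>x. x \<otimes> inv g"]) (use assms in \<open>auto simp: m_assoc\<close>)

lemma sum_translate:
  "g \<in> carrier G \<Longrightarrow> sum (translate g f) (carrier G) = sum f (carrier G)"
  unfolding translate_def by (rule sum.reindex_bij_betw[OF bij_betw_mult_right])

lemma inner_on_translate:
  "g \<in> carrier G \<Longrightarrow> inner_on (translate g f) (translate g k) = inner_on f k"
  using sum_translate[of g "\<lambda>x. f x * k x"] by (simp add: inner_on_def translate_def)

lemma convolve_translate:
  assumes "D \<subseteq> carrier G" "g \<in> carrier G" "x \<in> carrier G"
  shows "convolve D (translate g f) x = translate g (convolve D f) x"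
  unfolding convolve_def translate_def
  by (rule sum.cong) (use assms in \<open>auto simp: m_assoc\<close>)

lemma convolve_add: "convolve D (\<lambda>x. f x + g x) = (\<lambda>x. convolve D f x + convolve D g x)"
  by (simp add: convolve_def sum.distrib)

lemma convolve_scale: "convolve D (\<lambda>x. a * f x) = (\<lambda>x. a * convolve D f x)"
  by (simp add: convolve_def sum_distrib_left)

text \<open>Subtracting from \<open>v\<close> its projection onto \<open>w n\<close> preserves the
  coefficients at the earlier \<open>w j\<close> and lowers the square norm by exactly the last
  summand. The \<open>w j\<close> are not normalised, hence the denominators.\<close>

lemma bessel_inner_on:
  fixes w :: "nat \<Rightarrow> 'a \<Rightarrow> real"
  assumes "\<And>j. j < n \<Longrightarrow> inner_on (w j) (w j) \<noteq> 0"
    and "\<And>i j. i < n \<Longrightarrow> j < n \<Longrightarrow> i \<noteq> j \<Longrightarrow> inner_on (w i) (w j) = 0"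
  shows "(\<Sum>j<n. (inner_on v (w j))\<^sup>2 / inner_on (w j) (w j)) \<le> inner_on v v"
  using assms
proof (induction n arbitrary: v)
  case 0
  then show ?case by (simp add: inner_on_nonneg)
next
  case (Suc n)
  define a where "a = - inner_on v (w n) / inner_on (w n) (w n)"
  define v' where "v' = (\<lambda>x. v x + a * w n x)"
  have left: "inner_on v' k = inner_on v k + a * inner_on (w n) k" for k
    by (simp add: v'_def inner_on_add_left inner_on_scale_left)
  have "inner_on v' (w j) = inner_on v (w j)" if "j < n" for j
    using Suc.prems(2)[of n j] that by (simp add: left)
  then have "(\<Sum>j<n. (inner_on v (w j))\<^sup>2 / inner_on (w j) (w j)) =
      (\<Sum>j<n. (inner_on v' (w j))\<^sup>2 / inner_on (w j) (w j))"
    by simp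
  also have "\<dots> \<le> inner_on v' v'"
    by (rule Suc.IH) (use Suc.prems in auto)
  also have "inner_on v' v' = inner_on v v + 2 * a * inner_on v (w n) + a\<^sup>2 * inner_on (w n) (w n)"
    using left[of v'] left[of v] left[of "w n"]
    by (simp add: inner_on_commute[of v v'] inner_on_commute[of "w n" v'] inner_on_commute[of "w n" v]
        algebra_simps power2_eq_square)
  also have "\<dots> = inner_on v v - (inner_on v (w n))\<^sup>2 / inner_on (w n) (w n)"
    using Suc.prems(1)[of n] by (simp add: a_def field_simps power2_eq_square)
  finally show ?case by simp
qed

lemma cauchy_schwarz_inner_on: "(inner_on f g)\<^sup>2 \<le> inner_on f f * inner_on g g"
  unfolding inner_on_def using Cauchy_Schwarz_ineq_sum[of f g "carrier G"] by (simp add: power2_eq_square)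

text \<open>Row \<open>x\<close> of the matrix of the operator is the indicator of the translate
  \<open>D x\<close>. The square norms of these rows add up to the squared Hilbert-Schmidt
  norm.\<close>

lemma convolve_eq_inner_on:
  assumes "finite (carrier G)" "D \<subseteq> carrier G" "x \<in> carrier G"
  shows "convolve D f x = inner_on (\<lambda>z. of_bool (z \<otimes> inv x \<in> D)) f"
    and "inner_on (\<lambda>z. of_bool (z \<otimes> inv x \<in> D)) (\<lambda>z. of_bool (z \<otimes> inv x \<in> D)) = card D"
proof -
  have *: "inner_on (\<lambda>z. of_bool (z \<otimes> inv x \<in> D)) k = (\<Sum>y\<in>D. k (y \<otimes> x))" for k
  proof -
    have "inner_on (\<lambda>z. of_bool (z \<otimes> inv x \<in> D)) k =
        (\<Sum>y\<in>carrier G. of_bool (y \<otimes> x \<otimes> inv x \<in> D) * k (y \<otimes> x))"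
      unfolding inner_on_def
      by (rule sum.reindex_bij_betw[OF bij_betw_mult_right[OF assms(3)], symmetric])
    also have "\<dots> = (\<Sum>y\<in>carrier G. if y \<in> D then k (y \<otimes> x) else 0)"
      using assms(3) by (intro sum.cong) (auto simp: m_assoc)
    also have "\<dots> = (\<Sum>y\<in>D. k (y \<otimes> x))"
      using assms(1,2) by (simp add: sum.If_cases Int_absorb1)
    finally show ?thesis .
  qed
  then show "convolve D f x = inner_on (\<lambda>z. of_bool (z \<otimes> inv x \<in> D)) f"
    by (simp add: convolve_def)
  have "(\<Sum>y\<in>D. of_bool (y \<otimes> x \<otimes> inv x \<in> D)) = (\<Sum>y\<in>D. 1 :: real)"
    using assms by (intro sum.cong) (auto simp: m_assoc subset_iff)
  then show "inner_on (\<lambda>z. of_bool (z \<otimes> inv x \<in> D)) (\<lambda>z. of_bool (z \<otimes> inv x \<in> D)) = card D"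
    by (simp only: * ) simp
qed

text \<open>The quadratic form is continuous and homogeneous, so it suffices to maximise it on the
  unit sphere of the mean-zero functions, which is compact and, by \<open>ex\<close>,
  nonempty.\<close>

lemma convolve_maximiser:
  assumes fin: "finite (carrier G)"
    and ex: "sum f (carrier G) = 0" "inner_on f f \<noteq> 0"
    and D: "D \<subseteq> carrier G"
  obtains lam u where "sum u (carrier G) = 0" "inner_on u u \<noteq> 0"
    "inner_on (convolve D u) (convolve D u) = lam * inner_on u u"
    "\<And>g. sum g (carrier G) = 0 \<Longrightarrow> inner_on (convolve D g) (convolve D g) \<le> lam * inner_on g g"
proof -
  \<comment> \<open>The type \<open>'a\<close> may be infinite, so values off the carrier are pinned
    to 0. Tychonoff's theorem then makes the box compact, and the unit sphere lies in it because
    each coordinate is bounded by the norm.\<close>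
  define B where "B = Pi\<^sub>E UNIV (\<lambda>x. if x \<in> carrier G then {-1..1::real} else {0})"
  define K where "K = B \<inter> {f. sum f (carrier G) = 0} \<inter> {f. inner_on f f = 1}"
  define P where "P = (\<lambda>f. inner_on (convolve D f) (convolve D f))"
  have coord: "continuous_on S (\<lambda>f :: 'a \<Rightarrow> real. f x)" for S x
    by (rule continuous_on_subset[OF continuous_on_product_coordinates]) simp
  have "compactin (product_topology (\<lambda>_. euclidean) UNIV) B"
    unfolding B_def by (subst compactin_PiE) auto
  then have "compact B"
    by (simp add: euclidean_product_topology)
  moreover have "closed {f :: 'a \<Rightarrow> real. sum f (carrier G) = 0}"
    by (intro closed_Collect_eq continuous_on_sum continuous_on_const coord)
  moreover have "closed {f. inner_on f f = 1}"
    unfolding inner_on_def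
    by (intro closed_Collect_eq continuous_on_sum continuous_on_mult continuous_on_const coord)
  ultimately have K: "compact K"
    unfolding K_def by (simp add: compact_Int_closed)
  have cont: "continuous_on K P"
    unfolding P_def inner_on_def convolve_def
    by (intro continuous_on_sum continuous_on_mult coord)
  have cong: "P g = P g'" if "\<And>x. x \<in> carrier G \<Longrightarrow> g x = g' x" for g g'
    unfolding P_def convolve_def
    by (rule inner_on_cong; rule sum.cong) (use that D in auto)
  have norm: "\<exists>g'\<in>K. P g = inner_on g g * P g'"
    if g: "sum g (carrier G) = 0" "inner_on g g \<noteq> 0" for g
  proof -
    define n where "n = sqrt (inner_on g g)"
    have n: "n > 0" "n\<^sup>2 = inner_on g g"
      using g inner_on_nonneg[of g] by (auto simp: n_def)
    define g1 where "g1 = (\<lambda>x. (1/n) * g x)"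
    define g' where "g' = (\<lambda>x. if x \<in> carrier G then g1 x else 0)"
    have "inner_on g' g' = inner_on g1 g1"
      by (rule inner_on_cong) (auto simp: g'_def)
    also have "\<dots> = (1/n)\<^sup>2 * inner_on g g"
      unfolding g1_def by (rule inner_on_scale)
    also have "\<dots> = 1" using n(1) unfolding n(2)[symmetric] by (simp add: power_divide)
    finally have one: "inner_on g' g' = 1" .
    have bd: "\<bar>g' x\<bar> \<le> 1" if "x \<in> carrier G" for x
    proof -
      have "(g' x)\<^sup>2 \<le> inner_on g' g'"
        unfolding inner_on_def power2_eq_square by (rule member_le_sum) (use fin that in auto)
      then show ?thesis using one by (simp add: abs_square_le_1)
    qed
    have "sum g' (carrier G) = (1/n) * sum g (carrier G)"
      by (simp add: g'_def g1_def sum_divide_distrib)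
    then have "g' \<in> K"
      using bd one g by (auto simp: K_def B_def g'_def abs_le_iff)
    moreover have "P g' = P g1" by (rule cong) (simp add: g'_def)
    moreover have "P g1 = (1/n)\<^sup>2 * P g"
      unfolding P_def g1_def convolve_scale by (rule inner_on_scale)
    ultimately show ?thesis
      using n(1) unfolding n(2)[symmetric] by (intro bexI[of _ g']) (auto simp: power_divide)
  qed
  obtain g0 where "g0 \<in> K" using norm[OF ex] by blast
  then have "K \<noteq> {}" by blast
  then obtain u where u: "u \<in> K" "\<And>g. g \<in> K \<Longrightarrow> P g \<le> P u"
    using continuous_attains_sup[OF K _ cont] by blast
  show thesis
  proof (rule that[of u "P u"])
    show "sum u (carrier G) = 0" "inner_on u u \<noteq> 0"
      "inner_on (convolve D u) (convolve D u) = P u * inner_on u u"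
      using u(1) by (auto simp: K_def P_def)
    show "inner_on (convolve D g) (convolve D g) \<le> P u * inner_on g g"
      if g: "sum g (carrier G) = 0" for g
    proof (cases "inner_on g g = 0")
      case True
      then have "P g = P (\<lambda>_. 0)" using fin by (intro cong) (simp add: inner_on_eq_0_iff)
      then have "P g = 0" by (simp add: P_def convolve_def inner_on_def)
      then show ?thesis using True by (simp add: P_def)
    next
      case False
      obtain g' where "g' \<in> K" "P g = inner_on g g * P g'"
        using norm[OF g False] by blast
      then show ?thesis
        using u(2)[of g'] inner_on_nonneg[of g]
        by (metis P_def mult.commute mult_left_mono)
    qed
  qed
qed

text \<open>The maximisers form the kernel of a semidefinite form, hence a subspace.\<close>

lemma convolve_maximiser_combine:
  assumes max: "\<And>g. sum g (carrier G) = 0 \<Longrightarrow>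
      inner_on (convolve D g) (convolve D g) \<le> lam * inner_on g g"
    and f: "sum f (carrier G) = 0"
      "inner_on (convolve D f) (convolve D f) = lam * inner_on f f"
    and g: "sum g (carrier G) = 0"
      "inner_on (convolve D g) (convolve D g) = lam * inner_on g g"
  shows "inner_on (convolve D (\<lambda>x. f x + a * g x)) (convolve D (\<lambda>x. f x + a * g x)) =
    lam * inner_on (\<lambda>x. f x + a * g x) (\<lambda>x. f x + a * g x)"
proof -
  define b where "b = inner_on (convolve D f) (convolve D g) - lam * inner_on f g"
  have expand: "inner_on (\<lambda>x. f x + c * g x) (\<lambda>x. f x + c * g x) =
      inner_on f f + 2 * c * inner_on f g + c\<^sup>2 * inner_on g g" for f g c
    by (simp add: inner_on_def algebra_simps sum.distrib sum_distrib_left power2_eq_square)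
  \<comment> \<open>Both square terms cancel by maximality of \<open>f\<close> and \<open>g\<close>,
    leaving only the cross term, which is linear in \<open>c\<close>.\<close>
  have eq: "inner_on (convolve D (\<lambda>x. f x + c * g x)) (convolve D (\<lambda>x. f x + c * g x)) -
      lam * inner_on (\<lambda>x. f x + c * g x) (\<lambda>x. f x + c * g x) = 2 * c * b" for c
    by (simp add: convolve_add convolve_scale expand f g b_def algebra_simps)
  have "2 * c * b \<le> 0" for c
    unfolding eq[symmetric] using max[of "\<lambda>x. f x + c * g x"] f g
    by (simp add: sum.distrib flip: sum_distrib_left)
  \<comment> \<open>A linear function of \<open>c\<close> that is never positive has slope
    zero.\<close>
  from this[of 1] this[of "-1"] have "b = 0" by simp
  then show ?thesis using eq[of a] by simp
qed

end

section \<open>Orthogonal maximisers and the bound for product-free sets\<close>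

context flipping_group
begin

text \<open>The mean-zero condition excludes the trivial representation, so some \<open>t k\<close>
  acts nontrivially on \<open>E\<close>. This provides the eigenvalue -1 that the elements
  \<open>h j k\<close> use to flip signs.\<close>

lemma orthogonal_family:
  fixes E :: "('a \<Rightarrow> real) set"
  assumes fin: "finite (carrier G)"
    and mean: "\<And>f. f \<in> E \<Longrightarrow> sum f (carrier G) = 0"
    and comb: "\<And>f g a. f \<in> E \<Longrightarrow> g \<in> E \<Longrightarrow> (\<lambda>x. f x + a * g x) \<in> E"
    and trans: "\<And>f g. f \<in> E \<Longrightarrow> g \<in> carrier G \<Longrightarrow> translate g f \<in> E"
    and v0: "v0 \<in> E" "inner_on v0 v0 \<noteq> 0"
  obtains w :: "nat \<Rightarrow> 'a \<Rightarrow> real" where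
    "\<And>j. j < m \<Longrightarrow> w j \<in> E" "\<And>j. j < m \<Longrightarrow> inner_on (w j) (w j) \<noteq> 0"
    "\<And>i j. i < m \<Longrightarrow> j < m \<Longrightarrow> i \<noteq> j \<Longrightarrow> inner_on (w i) (w j) = 0"
proof -
  have "\<exists>k<m. \<exists>v\<in>E. \<exists>x\<in>carrier G. v (x \<otimes> t k) \<noteq> v x"
  proof (rule ccontr)
    assume *: "\<not> ?thesis"
    \<comment> \<open>\<open>N\<close> is the kernel of the translation action on \<open>E\<close>.
      If it contained every \<open>t j\<close> it would be the whole group, so \<open>v0\<close>
      would be constant of mean zero, hence zero.\<close>
    define N where "N = {g \<in> carrier G. \<forall>f\<in>E. \<forall>x\<in>carrier G. f (x \<otimes> g) = f x}"
    have sub: "subgroup N G"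
    proof (rule subgroupI)
      show "N \<subseteq> carrier G" "N \<noteq> {}" by (auto simp: N_def intro: exI[of _ \<one>])
      show "inv a \<in> N" if "a \<in> N" for a
      proof -
        have "f (x \<otimes> inv a) = f x" if "f \<in> E" "x \<in> carrier G" for f x
        proof -
          have "f (x \<otimes> inv a \<otimes> a) = f (x \<otimes> inv a)"
            using \<open>a \<in> N\<close> that by (simp add: N_def)
          then show ?thesis using \<open>a \<in> N\<close> that by (simp add: N_def m_assoc)
        qed
        then show ?thesis using that by (simp add: N_def)
      qed
      show "a \<otimes> b \<in> N" if "a \<in> N" "b \<in> N" for a b
        using that by (auto simp: N_def simp flip: m_assoc)
    qed
    have "x \<otimes> n \<otimes> inv x \<in> N" if x: "x \<in> carrier G" and n: "n \<in> N" for x n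
    proof -
      have "f (y \<otimes> (x \<otimes> n \<otimes> inv x)) = f y" if f: "f \<in> E" and y: "y \<in> carrier G" for f y
      proof -
        have nc: "n \<in> carrier G" using n by (simp add: N_def)
        have "translate (inv x) f (y \<otimes> x \<otimes> n) = translate (inv x) f (y \<otimes> x)"
          using n trans[OF f, of "inv x"] x y by (simp add: N_def)
        then show ?thesis using x y nc by (simp add: translate_def m_assoc)
      qed
      then show ?thesis using x n by (simp add: N_def)
    qed
    then have "N \<lhd> G" using sub by (simp add: normal_inv_iff)
    moreover have "t j \<in> N" if "j < m" for j
      using * that t_closed[OF that] by (auto simp: N_def)
    ultimately have N: "N = carrier G" by (rule t_normal)
    have const: "v0 x = v0 \<one>" if "x \<in> carrier G" for x
    proof -
      have "x \<in> N" using N that by simp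
      then have "v0 (\<one> \<otimes> x) = v0 \<one>" using v0(1) unfolding N_def by blast
      then show ?thesis using that by simp
    qed
    have "sum v0 (carrier G) = (\<Sum>x\<in>carrier G. v0 \<one>)"
      by (rule sum.cong[OF refl const])
    then have "card (carrier G) * v0 \<one> = 0" using mean[OF v0(1)] by simp
    moreover have "card (carrier G) \<noteq> 0" using fin by auto
    ultimately have "v0 \<one> = 0" by simp
    then have "\<forall>x\<in>carrier G. v0 x = 0" using const by metis
    then show False using v0(2) fin by (simp add: inner_on_eq_0_iff)
  qed
  then obtain k v where k: "k < m" and v: "v \<in> E" "\<exists>x\<in>carrier G. v (x \<otimes> t k) \<noteq> v x"
    by blast
  \<comment> \<open>Simultaneous diagonalisation, one involution at a time: the first
    \<open>i\<close> are already diagonal, while the eigenvalue -1 at \<open>t k\<close> is carried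
    along.\<close>
  define P where "P u i \<longleftrightarrow> u \<in> E \<and> inner_on u u \<noteq> 0 \<and> (\<forall>x\<in>carrier G. u (x \<otimes> t k) = - u x) \<and>
      (\<forall>l<i. \<exists>c\<in>{1,-1}. \<forall>x\<in>carrier G. u (x \<otimes> t l) = c * u x)" for u :: "'a \<Rightarrow> real" and i
  have "\<exists>u. P u i" if "i \<le> m" for i
    using that
  proof (induction i)
    case 0
    \<comment> \<open>Up to a factor 2 this projects \<open>v\<close> to the -1 eigenspace of
      \<open>t k\<close>; the result is nonzero since \<open>t k\<close> moves
      \<open>v\<close>.\<close>
    let ?u = "\<lambda>x. v x + (-1) * translate (t k) v x"
    have "?u \<in> E" using comb trans v t_closed k by blast
    moreover have "inner_on ?u ?u \<noteq> 0"
      using v(2) fin by (subst inner_on_eq_0_iff) (auto simp: translate_def intro: bexI dest: sym)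
    moreover have "?u (x \<otimes> t k) = - ?u x" if "x \<in> carrier G" for x
      using that k by (simp add: translate_def m_assoc t_closed t_square)
    ultimately show ?case unfolding P_def by (intro exI[of _ ?u]) simp
  next
    case (Suc i)
    then obtain u where u: "P u i" by auto
    have i: "i < m" using Suc by simp
    \<comment> \<open>This projects to the +1 eigenspace of \<open>t i\<close>, again up to a factor
      2. If it vanishes, \<open>u\<close> is itself a -1 eigenvector; otherwise it replaces
      \<open>u\<close>, and the earlier eigenvalues survive because the involutions commute.\<close>
    let ?u = "\<lambda>x. u x + 1 * translate (t i) u x"
    show ?case
    proof (cases "inner_on ?u ?u = 0")
      case True
      then have "\<forall>x\<in>carrier G. u (x \<otimes> t i) = - 1 * u x"
        using fin by (auto simp: inner_on_eq_0_iff translate_def add_eq_0_iff)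
      then have "P u (Suc i)" using u unfolding P_def by (simp add: less_Suc_eq)
      then show ?thesis by blast
    next
      case False
      have pres: "?u (x \<otimes> t l) = c * ?u x"
        if l: "l < m" and c: "\<forall>x\<in>carrier G. u (x \<otimes> t l) = c * u x" and x: "x \<in> carrier G" for l c x
      proof -
        have "u (x \<otimes> t l \<otimes> t i) = u (x \<otimes> t i \<otimes> t l)"
          using l i x t_commute by (simp add: m_assoc t_closed)
        also have "\<dots> = c * u (x \<otimes> t i)" using c x i t_closed by simp
        finally show ?thesis using c x by (simp add: translate_def algebra_simps)
      qed
      have "?u \<in> E" using u comb trans t_closed i unfolding P_def by blast
      moreover have "?u (x \<otimes> t k) = - ?u x" if "x \<in> carrier G" for x
        using pres[OF k, of "-1" x] u that unfolding P_def by simp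
      moreover have "\<exists>c\<in>{1,-1}. \<forall>x\<in>carrier G. ?u (x \<otimes> t l) = c * ?u x" if "l < Suc i" for l
      proof (cases "l = i")
        case True
        have "?u (x \<otimes> t i) = 1 * ?u x" if "x \<in> carrier G" for x
          using that i by (simp add: translate_def m_assoc t_closed t_square)
        then show ?thesis using True by blast
      next
        case False
        then have "l < i" using that by simp
        then obtain c where "c \<in> {1,-1}" "\<forall>x\<in>carrier G. u (x \<otimes> t l) = c * u x"
          using u unfolding P_def by blast
        then show ?thesis using pres[of l c] \<open>l < i\<close> i by (intro bexI[of _ c] ballI) auto
      qed
      ultimately have "P ?u (Suc i)" using False unfolding P_def by blast
      then show ?thesis by blast
    qed
  qed
  from this[of m] obtain u where u: "P u m" by blast
  then have "\<forall>l. \<exists>c. l < m \<longrightarrow> c \<in> {1,-1} \<and> (\<forall>x\<in>carrier G. u (x \<otimes> t l) = c * u x)"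
    unfolding P_def by blast
  then obtain c where c: "\<And>l. l < m \<Longrightarrow> c l \<in> {1,-1 :: real}"
      "\<And>l x. l < m \<Longrightarrow> x \<in> carrier G \<Longrightarrow> u (x \<otimes> t l) = c l * u x"
    by metis
  have uk: "u (x \<otimes> t k) = - u x" if "x \<in> carrier G" for x
    using u that unfolding P_def by blast
  define w where "w j = (if j = k then u else translate (h j k) u)" for j
  define s where "s j l = (if j \<noteq> k \<and> l = j then - c l else c l)" for j l
  have eig: "w j (x \<otimes> t l) = s j l * w j x" if j: "j < m" and l: "l < m" and x: "x \<in> carrier G" for j l x
  proof (cases "j = k")
    case True
    then show ?thesis using c l x by (simp add: w_def s_def)
  next
    case False
    have hc: "h j k \<in> carrier G" using h_closed j k False by blast
    show ?thesis
    proof (cases "l = j")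
      case True
      \<comment> \<open>Moving \<open>t j\<close> past \<open>h j k\<close> leaves a factor
        \<open>t k\<close>, where \<open>u\<close> has eigenvalue -1; this is the flip.\<close>
      have "u (x \<otimes> t j \<otimes> h j k) = u (x \<otimes> h j k \<otimes> t j \<otimes> t k)"
        using t_h_flip[OF j k False] x hc t_closed j k by (simp add: m_assoc)
      also have "\<dots> = - (c j * u (x \<otimes> h j k))"
        using uk c(2)[OF j] x hc t_closed[OF j] by simp
      finally show ?thesis using True False by (simp add: w_def s_def translate_def)
    next
      case ne: False
      have "u (x \<otimes> t l \<otimes> h j k) = u (x \<otimes> h j k \<otimes> t l)"
        using t_h_commute[OF j k l False ne] x hc t_closed l by (simp add: m_assoc)
      also have "\<dots> = c l * u (x \<otimes> h j k)" using c(2)[OF l] x hc by simp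
      finally show ?thesis using ne False by (simp add: w_def s_def translate_def)
    qed
  qed
  show thesis
  proof (rule that[of w])
    show "w j \<in> E" if "j < m" for j
      using u trans h_closed that k unfolding P_def w_def by auto
    show "inner_on (w j) (w j) \<noteq> 0" if "j < m" for j
      using u h_closed that k unfolding P_def w_def by (auto simp: inner_on_translate)
    show "inner_on (w i) (w j) = 0" if i: "i < m" and j: "j < m" and "i \<noteq> j" for i j
    proof -
      \<comment> \<open>An index from \<open>i\<close>, \<open>j\<close> other than
        \<open>k\<close>: exactly one of \<open>w i\<close> and \<open>w j\<close> is flipped there.
        As translation by \<open>t l\<close> is an isometry, the inner product equals its own
        negative.\<close>
      define l where "l = (if i = k then j else i)"
      have l: "l < m" using i j by (simp add: l_def)
      have "s i l * s j l = -1"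
        using c(1)[OF i] c(1)[OF j] \<open>i \<noteq> j\<close> by (auto simp: s_def l_def)
      moreover have "inner_on (w i) (w j) = (s i l * s j l) * inner_on (w i) (w j)"
      proof -
        have "inner_on (w i) (w j) = inner_on (translate (t l) (w i)) (translate (t l) (w j))"
          using l by (simp add: inner_on_translate t_closed)
        also have "\<dots> = inner_on (\<lambda>x. s i l * w i x) (\<lambda>x. s j l * w j x)"
          by (rule inner_on_cong) (use eig i j l in \<open>auto simp: translate_def\<close>)
        also have "\<dots> = (s i l * s j l) * inner_on (w i) (w j)"
          by (simp add: inner_on_def sum_distrib_left algebra_simps)
        finally show ?thesis .
      qed
      ultimately show ?thesis by simp
    qed
  qed
qed

text \<open>Each of the \<open>m\<close> orthogonal maximisers contributes \<open>lam\<close> to the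
  squared Hilbert-Schmidt norm, which is the group order times \<open>card D\<close>.\<close>

lemma convolve_bound:
  assumes fin: "finite (carrier G)" and D: "D \<subseteq> carrier G" and f: "sum f (carrier G) = 0"
  shows "m * inner_on (convolve D f) (convolve D f) \<le> card (carrier G) * card D * inner_on f f"
proof (cases "inner_on f f = 0")
  case True
  then have "\<forall>x\<in>carrier G. f x = 0" using fin by (simp add: inner_on_eq_0_iff)
  then have "\<forall>x\<in>carrier G. convolve D f x = 0"
    using D unfolding convolve_def by (intro ballI sum.neutral) auto
  then show ?thesis using True fin inner_on_eq_0_iff[of "convolve D f"] by simp
next
  case False
  obtain u lam where u: "sum u (carrier G) = 0" "inner_on u u \<noteq> 0"
    "inner_on (convolve D u) (convolve D u) = lam * inner_on u u"
    and max: "\<And>g. sum g (carrier G) = 0 \<Longrightarrow> inner_on (convolve D g) (convolve D g) \<le> lam * inner_on g g"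
    by (rule convolve_maximiser[OF fin f False D]) blast
  define E where "E = {f. sum f (carrier G) = 0 \<and>
      inner_on (convolve D f) (convolve D f) = lam * inner_on f f}"
  have comb: "(\<lambda>x. f x + a * g x) \<in> E" if "f \<in> E" "g \<in> E" for f g a
    using that convolve_maximiser_combine[of D lam f g a] max
    by (simp add: E_def sum.distrib flip: sum_distrib_left)
  have trans: "translate g f \<in> E" if "f \<in> E" "g \<in> carrier G" for f g
  proof -
    have "inner_on (convolve D (translate g f)) (convolve D (translate g f)) =
        inner_on (translate g (convolve D f)) (translate g (convolve D f))"
      by (rule inner_on_cong) (use D that convolve_translate in auto)
    then show ?thesis using that by (simp add: E_def sum_translate inner_on_translate)
  qed
  obtain w :: "nat \<Rightarrow> 'a \<Rightarrow> real" where w: "\<And>j. j < m \<Longrightarrow> w j \<in> E"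
    "\<And>j. j < m \<Longrightarrow> inner_on (w j) (w j) \<noteq> 0"
    "\<And>i j. i < m \<Longrightarrow> j < m \<Longrightarrow> i \<noteq> j \<Longrightarrow> inner_on (w i) (w j) = 0"
    by (rule orthogonal_family[OF fin _ comb trans, of u]) (use u in \<open>auto simp: E_def\<close>)
  define b where "b x = (\<lambda>z. of_bool (z \<otimes> inv x \<in> D) :: real)" for x
  have "m * lam = (\<Sum>j<m. inner_on (convolve D (w j)) (convolve D (w j)) / inner_on (w j) (w j))"
    using w by (simp add: E_def)
  also have "\<dots> = (\<Sum>j<m. \<Sum>x\<in>carrier G. (inner_on (b x) (w j))\<^sup>2 / inner_on (w j) (w j))"
  proof (rule sum.cong[OF refl])
    fix j
    have "inner_on (convolve D (w j)) (convolve D (w j)) = (\<Sum>x\<in>carrier G. (inner_on (b x) (w j))\<^sup>2)"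
      unfolding inner_on_def[of "convolve D (w j)"] b_def
      by (rule sum.cong) (use fin D convolve_eq_inner_on(1) in \<open>auto simp: power2_eq_square\<close>)
    then show "inner_on (convolve D (w j)) (convolve D (w j)) / inner_on (w j) (w j) =
        (\<Sum>x\<in>carrier G. (inner_on (b x) (w j))\<^sup>2 / inner_on (w j) (w j))"
      by (simp add: sum_divide_distrib)
  qed
  \<comment> \<open>With the sums exchanged, the inner one is bounded by Bessel's inequality for the
    row \<open>b x\<close>.\<close>
  also have "\<dots> = (\<Sum>x\<in>carrier G. \<Sum>j<m. (inner_on (b x) (w j))\<^sup>2 / inner_on (w j) (w j))"
    by (rule sum.swap)
  also have "\<dots> \<le> (\<Sum>x\<in>carrier G. inner_on (b x) (b x))"
    by (rule sum_mono, rule bessel_inner_on) (use w in auto)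
  also have "\<dots> = (\<Sum>x\<in>carrier G. real (card D))"
    by (rule sum.cong) (use fin D convolve_eq_inner_on(2) in \<open>auto simp: b_def\<close>)
  finally have lam: "m * lam \<le> card (carrier G) * card D" by simp
  have "m * inner_on (convolve D f) (convolve D f) \<le> (m * lam) * inner_on f f"
    using max[OF f] by (simp add: mult.assoc mult_left_mono)
  also have "\<dots> \<le> card (carrier G) * card D * inner_on f f"
    using lam by (rule mult_right_mono) (rule inner_on_nonneg)
  finally show ?thesis .
qed

text \<open>Product-freeness makes the indicator of \<open>D\<close> orthogonal to its convolution.
  Its mean-zero part then has a convolution whose inner product with the indicator is
  \<open>- (d ^ 3 / q)\<close>, which is large compared with the operator bound unless
  \<open>d / q\<close> is small.\<close>

theorem product_free_card_bound:
  assumes fin: "finite (carrier G)" and D: "D \<subseteq> carrier G"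
    and free: "\<And>x y. x \<in> D \<Longrightarrow> y \<in> D \<Longrightarrow> x \<otimes> y \<notin> D"
  shows "m * card D ^ 3 \<le> card (carrier G) ^ 3"
proof (cases "D = {}")
  case True
  then show ?thesis by simp
next
  case False
  define q d where "q = real (card (carrier G))" and "d = real (card D)"
  have finD: "finite D" using D fin finite_subset by blast
  have d: "d > 0" using False finD by (simp add: d_def card_gt_0_iff)
  have q: "q > 0" using fin by (auto simp: q_def card_gt_0_iff)
  define f where "f = (\<lambda>x. of_bool (x \<in> D) :: real)"
  \<comment> \<open>Subtracting the density \<open>d / q\<close> gives mean zero, as
    \<open>convolve_bound\<close> demands.\<close>
  define f0 where "f0 = (\<lambda>x. f x + (- (d / q)) * 1)"
  have sumf: "(\<Sum>x\<in>carrier G. f x * g x) = sum g D" for g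
    using D fin by (simp add: f_def if_distrib[of "\<lambda>x. x * _"] sum.If_cases Int_absorb1 of_bool_def)
  have "sum f (carrier G) = d" using sumf[of "\<lambda>_. 1"] by (simp add: d_def)
  then have mean: "sum f0 (carrier G) = 0"
    using q by (simp add: f0_def sum.distrib sum_subtractf flip: q_def)
  have conv: "convolve D f0 x = convolve D f x - d\<^sup>2 / q" for x
    by (simp add: convolve_def f0_def sum_subtractf power2_eq_square flip: d_def)
  have "inner_on f (convolve D f) = (\<Sum>x\<in>D. \<Sum>y\<in>D. f (y \<otimes> x))"
    by (simp add: inner_on_def sumf convolve_def)
  also have "\<dots> = 0" using free by (intro sum.neutral ballI) (simp add: f_def)
  finally have "inner_on f (convolve D f0) = - (d ^ 3 / q)"
    by (simp add: inner_on_def sumf conv sum_subtractf power2_eq_square power3_eq_cube flip: d_def)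
  then have "(d ^ 3 / q)\<^sup>2 \<le> inner_on f f * inner_on (convolve D f0) (convolve D f0)"
    using cauchy_schwarz_inner_on[of f "convolve D f0"] by simp
  moreover have ff: "inner_on f f = d"
  proof -
    have "inner_on f f = sum f D" by (simp add: inner_on_def sumf)
    also have "\<dots> = d" by (simp add: f_def d_def)
    finally show ?thesis .
  qed
  ultimately have "m * (d ^ 3 / q)\<^sup>2 \<le> d * (m * inner_on (convolve D f0) (convolve D f0))"
    by (metis mult.left_commute mult_left_mono of_nat_0_le_iff)
  also have "\<dots> \<le> d * (q * d * inner_on f0 f0)"
    using convolve_bound[OF fin D mean] d by (simp add: q_def d_def)
  also have "inner_on f0 f0 \<le> d"
  proof -
    have "inner_on f0 f0 = (\<Sum>x\<in>carrier G. f x * f x - 2 * (d / q) * f x + (d / q)\<^sup>2)"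
      unfolding inner_on_def f0_def by (rule sum.cong) (auto simp: algebra_simps power2_eq_square)
    also have "\<dots> = d - 2 * (d / q) * d + q * (d / q)\<^sup>2"
      using ff \<open>sum f (carrier G) = d\<close>
      by (simp add: sum.distrib sum_subtractf inner_on_def q_def flip: sum_distrib_left sum_divide_distrib)
    also have "\<dots> = d - d\<^sup>2 / q" using q by (simp add: field_simps power2_eq_square)
    also have "\<dots> \<le> d" using q by simp
    finally show ?thesis .
  qed
  \<comment> \<open>Clearing \<open>q\<close> and cancelling \<open>d ^ 3\<close> leaves the
    claim.\<close>
  finally have "m * (d ^ 3 / q)\<^sup>2 \<le> d * (q * d * d)" using d q by simp
  then have "m * d ^ 6 \<le> q ^ 3 * d ^ 3"
    using q by (simp add: power_divide field_simps power2_eq_square eval_nat_numeral)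
  then have "(m * d ^ 3) * d ^ 3 \<le> q ^ 3 * d ^ 3" by (simp add: eval_nat_numeral mult.assoc)
  then have "m * d ^ 3 \<le> q ^ 3" using d by simp
  then have "real (m * card D ^ 3) \<le> real (card (carrier G) ^ 3)" by (simp add: q_def d_def)
  then show ?thesis by (simp only: of_nat_le_iff)
qed

end

section \<open>From finite quotients to the basic measure\<close>

text \<open>Relations pass to images, and normal subgroups of the image are pulled back for
  \<open>t_normal\<close>. This serves both the finite quotients and the copy on the natural
  numbers.\<close>

lemma (in flipping_group) flipping_group_image:
  assumes "group H" and f: "f \<in> hom G H" and surj: "f ` carrier G = carrier H"
  shows "flipping_group H m (\<lambda>j. f (t j)) (\<lambda>j k. f (h j k))"
proof -
  interpret H: group H by fact
  interpret f: group_hom G H f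
    using f by (simp add: group_hom_def group_hom_axioms_def H.is_group is_group)
  note hom = f.hom_mult[symmetric]
  show ?thesis
  proof
    show "f (t j) \<in> carrier H" if "j < m" for j
      using that by (simp add: t_closed)
    show "f (h j k) \<in> carrier H" if "j < m" "k < m" "j \<noteq> k" for j k
      using that by (simp add: h_closed)
    show "f (t j) \<otimes>\<^bsub>H\<^esub> f (t j) = \<one>\<^bsub>H\<^esub>" if "j < m" for j
      using that by (simp add: hom t_closed t_square del: f.hom_mult)
    show "f (t j) \<otimes>\<^bsub>H\<^esub> f (t k) = f (t k) \<otimes>\<^bsub>H\<^esub> f (t j)" if "j < m" "k < m" for j k
      using that by (simp add: hom t_closed t_commute del: f.hom_mult)
    show "f (t l) \<otimes>\<^bsub>H\<^esub> f (h j k) = f (h j k) \<otimes>\<^bsub>H\<^esub> f (t l)"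
      if "j < m" "k < m" "l < m" "j \<noteq> k" "l \<noteq> j" for j k l
      using that by (simp add: hom t_closed h_closed t_h_commute del: f.hom_mult)
    show "f (t j) \<otimes>\<^bsub>H\<^esub> f (h j k) = f (h j k) \<otimes>\<^bsub>H\<^esub> (f (t j) \<otimes>\<^bsub>H\<^esub> f (t k))"
      if "j < m" "k < m" "j \<noteq> k" for j k
      using that by (simp add: hom t_closed h_closed t_h_flip del: f.hom_mult)
    show "N = carrier H" if N: "N \<lhd> H" and tN: "\<And>j. j < m \<Longrightarrow> f (t j) \<in> N" for N
    proof -
      define M where "M = {g \<in> carrier G. f g \<in> N}"
      have sub: "subgroup N H" using N by (rule normal_imp_subgroup)
      have one: "\<one> \<in> M" using subgroup.one_closed[OF sub] by (simp add: M_def)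
      have "subgroup M G"
        by (rule subgroupI)
          (use one in \<open>auto simp: M_def subgroup.m_closed[OF sub] subgroup.m_inv_closed[OF sub]\<close>)
      moreover have "x \<otimes> g \<otimes> inv x \<in> M" if "x \<in> carrier G" "g \<in> M" for x g
        using that normal.inv_op_closed2[OF N, of "f x" "f g"] by (simp add: M_def)
      ultimately have "M \<lhd> G" by (simp add: normal_inv_iff)
      then have "M = carrier G" by (rule t_normal) (simp add: M_def t_closed tN)
      then have "carrier H \<subseteq> N" unfolding surj[symmetric] M_def by blast
      then show ?thesis using subgroup.subset[OF sub] by blast
    qed
  qed
qed

text \<open>A measurable set is the preimage of a set \<open>D\<close> in a finite quotient, its
  measure is the density of \<open>D\<close>, and product-freeness descends to \<open>D\<close> by
  choosing representatives.\<close>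

lemma (in flipping_group) basic_measure_product_free:
  assumes S: "S \<in> measurable_subsets G" and free: "product_free G S"
  shows "m * basic_measure G S ^ 3 \<le> 1"
proof -
  obtain R D where R: "finite_index_normal R G" and D: "D \<subseteq> rcosets R" and SD: "S = \<Union>D"
    using measurable_imp_union_cosets[OF S] by blast
  have nor: "R \<lhd> G" and fin: "finite (rcosets R)"
    using R by (auto simp: finite_index_normal_def)
  interpret R: normal R G by (rule nor)
  let ?Q = "G Mod R"
  have carrier: "carrier ?Q = rcosets R" by (simp add: FactGroup_def)
  interpret Q: flipping_group ?Q m "\<lambda>j. R #> t j" "\<lambda>j k. R #> h j k"
    using flipping_group_image[OF R.factorgroup_is_group R.r_coset_hom_Mod]
    by (simp add: carrier_FactGroup)
  have "X \<otimes>\<^bsub>?Q\<^esub> Y \<notin> D" if X: "X \<in> D" and Y: "Y \<in> D" for X Y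
  proof
    assume XY: "X \<otimes>\<^bsub>?Q\<^esub> Y \<in> D"
    obtain x y where "x \<in> X" "y \<in> Y"
      using X Y D R.rcosets_non_empty by blast
    then have "x \<otimes> y \<in> X \<otimes>\<^bsub>?Q\<^esub> Y" by (auto simp: set_mult_def)
    then have "x \<otimes> y \<in> S" using XY SD by blast
    moreover have "x \<otimes> y \<in> S <#> S"
      using \<open>x \<in> X\<close> \<open>y \<in> Y\<close> X Y SD by (auto simp: set_mult_def)
    ultimately show False using free by (auto simp: product_free_def)
  qed
  then have "m * card D ^ 3 \<le> card (rcosets R) ^ 3"
    using Q.product_free_card_bound[of D] fin D by (simp add: carrier)
  then have "real m * real (card D) ^ 3 \<le> real (card (rcosets R)) ^ 3"
    by (metis of_nat_le_iff of_nat_mult of_nat_power)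
  moreover have "card (rcosets R) > 0"
    using fin R.subgroup_in_rcosets[OF is_group] by (auto simp: card_gt_0_iff)
  ultimately show ?thesis
    by (simp add: basic_measure_eqI[OF R D SD] power_divide divide_le_eq)
qed

text \<open>The parameter \<open>c\<close> avoids cube roots.\<close>

lemma (in flipping_group) alpha_bound:
  fixes c :: real
  assumes "c \<ge> 0" "m * c ^ 3 \<ge> 1"
  shows "alpha G \<le> c"
  unfolding alpha_def
proof (rule cSup_least)
  show "{basic_measure G S | S. S \<in> measurable_subsets G \<and> product_free G S} \<noteq> {}"
    using measurable_product_free_values(2) by blast
next
  fix v assume "v \<in> {basic_measure G S | S. S \<in> measurable_subsets G \<and> product_free G S}"
  then have "m * v ^ 3 \<le> m * c ^ 3"
    using basic_measure_product_free assms(2) by force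
  moreover have "m > 0" using assms(2) by (cases m) auto
  ultimately have "v ^ 3 \<le> c ^ 3" by simp
  then show "v \<le> c" using assms(1) power_mono_iff by (metis power_le_imp_le_base numeral_3_eq_3)
qed

section \<open>Residual finiteness and countability\<close>

text \<open>If \<open>g\<close> moves \<open>x\<close>, the group acts on the finite orbit of
  \<open>x\<close>, and the kernel of this action is normal, of finite index, and misses
  \<open>g\<close>.\<close>

lemma (in group) residually_finite_if_finite_orbits:
  fixes act :: "'a \<Rightarrow> 'x \<Rightarrow> 'x"
  assumes one: "act \<one> = id"
    and mult: "\<And>a b. a \<in> carrier G \<Longrightarrow> b \<in> carrier G \<Longrightarrow> act (a \<otimes> b) = act a \<circ> act b"
    and faithful: "\<And>a. a \<in> carrier G \<Longrightarrow> act a = id \<Longrightarrow> a = \<one>"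
    and orbits: "\<And>x. finite ((\<lambda>a. act a x) ` carrier G)"
  shows "residually_finite G"
  unfolding residually_finite_def
proof (intro ballI impI)
  fix g assume g: "g \<in> carrier G" "g \<noteq> \<one>"
  then obtain x where x: "act g x \<noteq> x" using faithful by fastforce
  define orb where "orb = (\<lambda>a. act a x) ` carrier G"
  have fin: "finite orb" unfolding orb_def by (rule orbits)
  have orb: "act a y \<in> orb" if "a \<in> carrier G" "y \<in> orb" for a y
  proof -
    obtain b where b: "b \<in> carrier G" "y = act b x" using \<open>y \<in> orb\<close> by (auto simp: orb_def)
    then have "act a y = act (a \<otimes> b) x" using \<open>a \<in> carrier G\<close> by (simp add: mult)
    then show ?thesis using \<open>a \<in> carrier G\<close> b(1) by (auto simp: orb_def)
  qed
  have act_inv: "act (inv a) (act a y) = y" "act a (act (inv a) y) = y"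
    if "a \<in> carrier G" for a y
    using that mult[of "inv a" a] mult[of a "inv a"] one by (auto simp: fun_eq_iff)
  define R where "R = {a \<in> carrier G. \<forall>y\<in>orb. act a y = y}"
  have sub: "subgroup R G"
  proof (rule subgroupI)
    show "R \<subseteq> carrier G" "R \<noteq> {}" using one by (auto simp: R_def intro: exI[of _ \<one>])
    show "inv a \<in> R" if "a \<in> R" for a
      using that act_inv(1)[of a] by (auto simp: R_def) metis
    show "a \<otimes> b \<in> R" if "a \<in> R" "b \<in> R" for a b
      using that by (auto simp: R_def mult)
  qed
  have "a \<otimes> k \<otimes> inv a \<in> R" if "a \<in> carrier G" "k \<in> R" for a k
    using that orb[of "inv a"] act_inv(2)[of a] by (auto simp: R_def mult)
  then have "R \<lhd> G" using sub by (simp add: normal_inv_iff)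
  moreover have "finite (rcosets R)"
  proof -
    \<comment> \<open>The coset of \<open>a\<close> is determined by the map that \<open>a\<close>
      induces on \<open>orb\<close>, and \<open>orb\<close> has only finitely many
      self-maps.\<close>
    define f where "f a = restrict (act a) orb" for a
    have "R #> a = R #> b" if a: "a \<in> carrier G" and b: "b \<in> carrier G" and eq: "f a = f b" for a b
    proof -
      have "act a y = act b y" if "y \<in> orb" for y
        using fun_cong[OF eq, of y] that by (simp add: f_def)
      then have "a \<otimes> inv b \<in> R"
        using a b orb[of "inv b"] act_inv(2)[of b] by (auto simp: R_def mult)
      then have "a \<in> R #> b" by (metis a b sub subgroup.rcos_module is_group)
      then show ?thesis using repr_independence[OF _ b sub] by blast
    qed
    then have "R #> a = R #> inv_into (carrier G) f (f a)" if "a \<in> carrier G" for a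
      using that by (metis f_inv_into_f imageI inv_into_into)
    then have "rcosets R \<subseteq> (\<lambda>u. R #> inv_into (carrier G) f u) ` f ` carrier G"
      unfolding RCOSETS_def by blast
    moreover have "f ` carrier G \<subseteq> orb \<rightarrow>\<^sub>E orb" using orb by (auto simp: f_def)
    then have "finite (f ` carrier G)" using fin by (meson finite_PiE finite_subset)
    ultimately show ?thesis by (meson finite_imageI finite_subset)
  qed
  moreover have "x \<in> orb" using one by (auto simp: orb_def intro!: image_eqI[of _ _ \<one>])
  then have "g \<notin> R" using x by (auto simp: R_def)
  ultimately show "\<exists>R. finite_index_normal R G \<and> g \<notin> R"
    by (auto simp: finite_index_normal_def)
qed

text \<open>Elements are products of words over the countable alphabet of generators and their
  inverses.\<close>

lemma (in group) countable_generate: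
  assumes "countable K" and K: "K \<subseteq> carrier G"
  shows "countable (generate G K)"
proof -
  let ?L = "lists (K \<union> m_inv G ` K)" and ?p = "\<lambda>xs. foldr (\<otimes>) xs \<one>"
  have closed: "?p xs \<in> carrier G" if "xs \<in> ?L" for xs
    using that K by (induction xs) auto
  have append: "?p (xs @ ys) = ?p xs \<otimes> ?p ys" if "xs \<in> ?L" "ys \<in> ?L" for xs ys
    using that(1)
  proof (induction xs)
    case Nil
    then show ?case using closed[OF that(2)] by simp
  next
    case (Cons a xs)
    then show ?case using K closed[OF Cons.hyps(2)] closed[OF that(2)] by (auto simp: m_assoc)
  qed
  have "g \<in> ?p ` ?L" if "g \<in> generate G K" for g
    using that
  proof induction
    case one
    show ?case by (rule image_eqI[of _ _ "[]"]) auto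
  next
    case (incl a)
    then show ?case using K by (intro image_eqI[of _ _ "[a]"]) auto
  next
    case (inv a)
    then show ?case using K by (intro image_eqI[of _ _ "[m_inv G a]"]) auto
  next
    case (eng a b)
    then obtain xs ys where xy: "xs \<in> ?L" "ys \<in> ?L" and "a = ?p xs" "b = ?p ys" by blast
    then have "a \<otimes> b = ?p (xs @ ys)" using append[OF xy] by simp
    moreover have "xs @ ys \<in> ?L" using xy by simp
    ultimately show ?case by (rule image_eqI)
  qed
  moreover have "countable (?p ` ?L)" using assms(1) by simp
  ultimately show ?thesis by (meson countable_subset subsetI)
qed

text \<open>Provides a group on the type \<open>nat\<close>, as the final statement asks. The map
  \<open>e\<close> transports generators and the flipping structure, \<open>d\<close> the faithful
  action.\<close>

lemma (in group) nat_copy: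
  assumes "countable (carrier G)" "infinite (carrier G)"
  obtains H :: "nat monoid" and e d where "group H" "infinite (carrier H)"
    "e \<in> hom G H" "e ` carrier G = carrier H" "d \<in> hom H G" "inj_on d (carrier H)"
proof -
  define e where "e = to_nat_on (carrier G)"
  define d where "d = from_nat_into (carrier G)"
  have ed: "e (d n) = n" for n
    using assms by (simp add: e_def d_def)
  have de: "d (e a) = a" if "a \<in> carrier G" for a
    using assms that by (simp add: e_def d_def)
  have d: "d n \<in> carrier G" for n
    unfolding d_def by (rule from_nat_into) (use assms(2) in auto)
  define H :: "nat monoid" where
    "H = \<lparr>carrier = UNIV, monoid.mult = (\<lambda>x y. e (d x \<otimes> d y)), one = e \<one>\<rparr>"
  have "group H"
  proof (rule groupI)
    show "\<exists>y\<in>carrier H. y \<otimes>\<^bsub>H\<^esub> x = \<one>\<^bsub>H\<^esub>" if "x \<in> carrier H" for x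
      by (rule bexI[of _ "e (inv (d x))"]) (simp_all add: H_def de d)
  qed (simp_all add: H_def de d ed m_assoc)
  moreover have "inj d" by (metis ed injI)
  moreover have "e ` carrier G = UNIV" using d ed by (metis UNIV_eq_I imageI)
  ultimately show thesis
    by (intro that[of H e d]) (auto simp: H_def hom_def de d ed inj_on_def)
qed

section \<open>Elementary matrices over the polynomials mod 2\<close>

text \<open>Binary expansion makes a natural number a vector over the field with two elements, with \<open>xor\<close> as
  addition, and \<open>x\<close> acts by dropping the lowest bit. Then \<open>transvection i j r\<close> is the action of
  the elementary matrix with entry \<open>x ^ r\<close> in position \<open>(i, j)\<close>.\<close>

definition transvection :: "nat \<Rightarrow> nat \<Rightarrow> nat \<Rightarrow> (nat \<Rightarrow> nat) \<Rightarrow> nat \<Rightarrow> nat" where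
  "transvection i j r v = v(i := xor (v i) (drop_bit r (v j)))"

lemma xor_left_self: "xor a (xor a b) = (b :: nat)"
  by (simp flip: xor.assoc)

lemma transvection_involution: "i \<noteq> j \<Longrightarrow> transvection i j r \<circ> transvection i j r = id"
  by (auto simp: transvection_def fun_eq_iff xor.assoc)

text \<open>The Steinberg relation; the factors are involutions, so the commutator is written
  without inverses.\<close>

lemma transvection_commutator:
  "distinct [i, j, k] \<Longrightarrow>
    transvection i j r \<circ> transvection j k s \<circ> transvection i j r \<circ> transvection j k s = transvection i k (r + s)"
  by (auto simp: transvection_def fun_eq_iff xor.assoc xor.commute xor.left_commute xor_left_self add.commute)

lemma transvection_commute_row:
  "i \<noteq> j \<Longrightarrow> i \<noteq> k \<Longrightarrow> transvection i j r \<circ> transvection i k s = transvection i k s \<circ> transvection i j r"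
  by (auto simp: transvection_def fun_eq_iff xor.assoc xor.commute xor.left_commute)

lemma transvection_commute_disjoint:
  "l \<noteq> j \<Longrightarrow> i \<noteq> j \<Longrightarrow> i \<noteq> k \<Longrightarrow> transvection i l r \<circ> transvection j k s = transvection j k s \<circ> transvection i l r"
  by (auto simp: transvection_def fun_eq_iff)

text \<open>The Steinberg relation for exponent 0, rearranged into the shape of
  \<open>t_h_flip\<close>.\<close>

lemma transvection_flip:
  "distinct [i, j, k] \<Longrightarrow> transvection i j 0 \<circ> transvection j k 0 = transvection j k 0 \<circ> (transvection i j 0 \<circ> transvection i k 0)"
  by (auto simp: transvection_def fun_eq_iff xor.assoc xor.commute xor.left_commute)

lemma bij_transvection: "i \<noteq> j \<Longrightarrow> bij (transvection i j r)"
  using transvection_involution o_bij by blast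

lemma inj_transvection:
  assumes "i \<noteq> j" shows "inj (transvection i j)"
proof (rule linorder_injI)
  fix r s :: nat assume "r < s"
  \<comment> \<open>Dropping \<open>r\<close> bits of \<open>2 ^ r\<close> leaves 1, dropping more
    leaves 0.\<close>
  then have "transvection i j r ((\<lambda>_. 0)(j := 2 ^ r)) i \<noteq> transvection i j s ((\<lambda>_. 0)(j := 2 ^ r)) i"
    using assms by (simp add: transvection_def drop_bit_eq_div)
  then show "transvection i j r \<noteq> transvection i j s" by metis
qed

section \<open>The elementary group as a group of permutations of vectors\<close>

lemma carrier_BijGroup_UNIV: "carrier (BijGroup UNIV) = {f. bij f}"
  by (auto simp: BijGroup_def Bij_def extensional_def)

lemma mult_BijGroup_UNIV: "bij f \<Longrightarrow> bij g \<Longrightarrow> f \<otimes>\<^bsub>BijGroup UNIV\<^esub> g = f \<circ> g"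
  by (auto simp: BijGroup_def Bij_def extensional_def compose_def)

lemma one_BijGroup_UNIV: "\<one>\<^bsub>BijGroup UNIV\<^esub> = id"
  by (auto simp: BijGroup_def)

definition transvections :: "nat \<Rightarrow> ((nat \<Rightarrow> nat) \<Rightarrow> nat \<Rightarrow> nat) set" where
  "transvections n = {transvection i j r | i j r. i < n \<and> j < n \<and> i \<noteq> j \<and> r \<le> 1}"

definition EL :: "nat \<Rightarrow> ((nat \<Rightarrow> nat) \<Rightarrow> nat \<Rightarrow> nat) monoid" where
  "EL n = (BijGroup UNIV)\<lparr>carrier := generate (BijGroup UNIV) (transvections n)\<rparr>"

lemma transvections_subset: "transvections n \<subseteq> carrier (BijGroup UNIV)"
  by (auto simp: transvections_def carrier_BijGroup_UNIV bij_transvection)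

lemma finite_transvections: "finite (transvections n)"
proof -
  have "transvections n \<subseteq> (\<Union>i<n. \<Union>j<n. \<Union>r\<le>1. {transvection i j r})"
    unfolding transvections_def by blast
  then show ?thesis by (rule finite_subset) simp
qed

lemma subgroup_EL: "subgroup (carrier (EL n)) (BijGroup UNIV)"
  using group.generate_is_subgroup[OF group_BijGroup transvections_subset] by (simp add: EL_def)

lemma group_EL: "group (EL n)"
  using subgroup.subgroup_is_group[OF subgroup_EL[of n] group_BijGroup] by (simp add: EL_def)

lemma bij_EL: "g \<in> carrier (EL n) \<Longrightarrow> bij g"
  using subgroup.subset[OF subgroup_EL[of n]] by (auto simp: carrier_BijGroup_UNIV)

lemma mult_EL: "f \<in> carrier (EL n) \<Longrightarrow> g \<in> carrier (EL n) \<Longrightarrow> f \<otimes>\<^bsub>EL n\<^esub> g = f \<circ> g"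
  using mult_BijGroup_UNIV[of f g] bij_EL[of f n] bij_EL[of g n] by (simp add: EL_def)

lemma comp_EL: "f \<in> carrier (EL n) \<Longrightarrow> g \<in> carrier (EL n) \<Longrightarrow> f \<circ> g \<in> carrier (EL n)"
  by (metis mult_EL group_EL group.is_monoid monoid.m_closed)

lemma one_EL: "\<one>\<^bsub>EL n\<^esub> = id"
  by (simp add: EL_def one_BijGroup_UNIV)

lemma generate_EL: "transvections n \<subseteq> carrier (EL n)" "generate (EL n) (transvections n) = carrier (EL n)"
proof -
  show sub: "transvections n \<subseteq> carrier (EL n)" by (auto simp: EL_def intro: generate.incl)
  show "generate (EL n) (transvections n) = carrier (EL n)"
    using group.generate_consistent[OF group_BijGroup sub subgroup_EL] by (simp add: EL_def)
qed

text \<open>A third index \<open>k\<close> exists as \<open>n \<ge> 3\<close>, and the commutator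
  through \<open>k\<close> with an exponent 1 generator raises the exponent by one.\<close>

lemma transvection_in_EL:
  assumes n: "n \<ge> 3" and "i < n" "j < n" "i \<noteq> j"
  shows "transvection i j r \<in> carrier (EL n)"
  using assms(2-)
proof (induction r arbitrary: i j)
  case 0
  then show ?case using generate_EL(1) by (fastforce simp: transvections_def)
next
  case (Suc r)
  have "card {i, j} < card {..<n}" using n by (auto simp: card_insert_if)
  then have "\<not> {..<n} \<subseteq> {i, j}" by (meson card_mono finite.intros linorder_not_less)
  then obtain k where k: "k < n" "k \<noteq> i" "k \<noteq> j" by blast
  have "transvection i k r \<in> carrier (EL n)" using Suc k by simp
  moreover have "transvection k j 1 \<in> carrier (EL n)"
    using generate_EL(1) Suc.prems k by (fastforce simp: transvections_def)
  ultimately show ?case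
    using transvection_commutator[of i k j r 1] k Suc.prems comp_EL
    by (metis Suc_eq_plus1 distinct_length_2_or_more distinct_singleton)
qed

lemma xor_less_power: "a < 2 ^ K \<Longrightarrow> b < 2 ^ K \<Longrightarrow> xor a b < (2 ^ K :: nat)"
  by (metis take_bit_nat_eq_self_iff take_bit_xor)

text \<open>Generators change only coordinates below \<open>n\<close>, and neither
  \<open>xor\<close> nor \<open>drop_bit\<close> creates higher bits, so the orbit stays in a finite
  box.\<close>

lemma finite_orbit_EL: "finite ((\<lambda>g. g v) ` carrier (EL n))"
proof -
  \<comment> \<open>A crude common bit length: \<open>v i \<le> K < 2 ^ K\<close> for
    \<open>i < n\<close>.\<close>
  define K where "K = (\<Sum>i<n. v i)"
  define V where "V = {w. (\<forall>i<n. w i < 2 ^ K) \<and> (\<forall>i\<ge>n. w i = v i)}"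
  have "V \<subseteq> (\<lambda>w i. if i < n then w i else v i) ` ({..<n} \<rightarrow>\<^sub>E {..<2 ^ K})"
  proof
    fix w assume "w \<in> V"
    then show "w \<in> (\<lambda>w i. if i < n then w i else v i) ` ({..<n} \<rightarrow>\<^sub>E {..<2 ^ K})"
      by (intro image_eqI[of _ _ "restrict w {..<n}"]) (auto simp: V_def)
  qed
  then have "finite V" by (rule finite_subset) (simp add: finite_PiE)
  have v: "v \<in> V"
  proof -
    have "v i < 2 ^ K" if "i < n" for i
    proof -
      have "v i \<le> K" unfolding K_def by (rule member_le_sum) (use that in auto)
      also have "K < 2 ^ K" by (rule less_exp)
      finally show ?thesis .
    qed
    then show ?thesis by (simp add: V_def)
  qed
  have step: "f w \<in> V" if f: "f \<in> transvections n" and w: "w \<in> V" for f w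
  proof -
    obtain i j r where f: "f = transvection i j r" and ij: "i < n" "j < n"
      using f by (auto simp: transvections_def)
    have "drop_bit r (w j) \<le> w j" by (simp add: drop_bit_eq_div)
    then have "xor (w i) (drop_bit r (w j)) < 2 ^ K"
      using w ij by (intro xor_less_power) (auto simp: V_def intro: le_less_trans)
    then show ?thesis using w ij by (auto simp: f transvection_def V_def)
  qed
  have "g w \<in> V" if "g \<in> generate (EL n) (transvections n)" "w \<in> V" for g w
    using that
  proof (induction arbitrary: w)
    case one
    then show ?case by (simp add: one_EL)
  next
    case (incl f)
    then show ?case by (simp add: step)
  next
    case (inv f)
    have f: "f \<in> carrier (EL n)" using inv generate_EL(1) by blast
    obtain i j r where "f = transvection i j r" "i \<noteq> j"
      using inv by (auto simp: transvections_def)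
    then have "f \<otimes>\<^bsub>EL n\<^esub> f = \<one>\<^bsub>EL n\<^esub>"
      using f by (simp add: mult_EL one_EL transvection_involution)
    then have "inv\<^bsub>EL n\<^esub> f = f" using group.inv_equality[OF group_EL _ f f] by blast
    then show ?case using inv by (simp add: step)
  next
    case (eng f g)
    then have "f \<in> carrier (EL n)" "g \<in> carrier (EL n)" by (simp_all add: generate_EL(2))
    then show ?case using eng by (simp add: mult_EL)
  qed
  then have "(\<lambda>g. g v) ` carrier (EL n) \<subseteq> V" using v by (auto simp: generate_EL(2))
  then show ?thesis using \<open>finite V\<close> by (rule finite_subset)
qed

lemma infinite_EL:
  assumes n: "n \<ge> 3"
  shows "infinite (carrier (EL n))"
proof -
  have "infinite (range (transvection 0 1))" by (rule range_inj_infinite[OF inj_transvection]) simp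
  moreover have "range (transvection 0 1) \<subseteq> carrier (EL n)"
    using transvection_in_EL[OF n, of 0 1] n by auto
  ultimately show ?thesis by (meson finite_subset)
qed

text \<open>Commutators with elements of \<open>N\<close> stay in \<open>N\<close>. From row 0 with
  exponent 0 they reach row 0 with every exponent, then the positions outside row and column 0, and
  finally column 0.\<close>

lemma normal_EL_eq_carrier:
  assumes n: "n \<ge> 3" and N: "N \<lhd> EL n"
    and row: "\<And>j. 0 < j \<Longrightarrow> j < n \<Longrightarrow> transvection 0 j 0 \<in> N"
  shows "N = carrier (EL n)"
proof -
  interpret group "EL n" by (rule group_EL)
  note mem = transvection_in_EL[OF n]
  have sub: "subgroup N (EL n)" using N by (rule normal_imp_subgroup)
  have conj: "f \<circ> g \<circ> f \<in> N" if "f \<circ> f = id" "f \<in> carrier (EL n)" "g \<in> N" for f g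
  proof -
    have g: "g \<in> carrier (EL n)" using that subgroup.subset[OF sub] by blast
    have "inv\<^bsub>EL n\<^esub> f = f" using that by (intro inv_equality) (simp_all add: mult_EL one_EL)
    then show ?thesis
      using normal.inv_op_closed2[OF N that(2,3)] that g by (simp add: mult_EL comp_EL)
  qed
  have comp: "f \<circ> g \<in> N" if "f \<in> N" "g \<in> N" for f g
    using subgroup.m_closed[OF sub that] that subgroup.subset[OF sub] by (simp add: mult_EL subset_iff)
  \<comment> \<open>The commutator is an element of \<open>N\<close> times a conjugate of it;
    \<open>right\<close> treats the mirrored case.\<close>
  have left: "transvection i k (r + s) \<in> N"
    if "distinct [i, j, k]" "i < n" "j < n" "k < n" "transvection i j r \<in> N" for i j k r s
  proof -
    have "transvection i j r \<circ> (transvection j k s \<circ> transvection i j r \<circ> transvection j k s) \<in> N"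
      using that by (intro comp conj mem) (auto simp: transvection_involution)
    then show ?thesis using transvection_commutator[OF that(1), of r s] by (simp add: comp_assoc)
  qed
  have right: "transvection i k (r + s) \<in> N"
    if "distinct [i, j, k]" "i < n" "j < n" "k < n" "transvection j k s \<in> N" for i j k r s
  proof -
    have "(transvection i j r \<circ> transvection j k s \<circ> transvection i j r) \<circ> transvection j k s \<in> N"
      using that by (intro comp conj mem) (auto simp: transvection_involution)
    then show ?thesis using transvection_commutator[OF that(1), of r s] by simp
  qed
  have third: "\<exists>k. 0 < k \<and> k < n \<and> k \<noteq> j" for j
    using n by (intro exI[of _ "if j = 1 then 2 else 1"]) auto
  have row: "transvection 0 j r \<in> N" if j: "0 < j" "j < n" for j r
  proof -
    obtain k where "0 < k" "k < n" "k \<noteq> j" using third by blast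
    then show ?thesis using left[of 0 k j 0 r] row j by simp
  qed
  have block: "transvection i j r \<in> N" if "0 < i" "i < n" "0 < j" "j < n" "i \<noteq> j" for i j r
    using right[of i 0 j r 0] row[of j r] that by simp
  have col: "transvection i 0 r \<in> N" if i: "0 < i" "i < n" for i r
  proof -
    obtain k where "0 < k" "k < n" "k \<noteq> i" using third by blast
    then show ?thesis using left[of i k 0 r 0] block i by simp
  qed
  have "transvections n \<subseteq> N"
  proof
    fix f assume "f \<in> transvections n"
    then obtain i j r where f: "f = transvection i j r" "i < n" "j < n" "i \<noteq> j"
      by (auto simp: transvections_def)
    then show "f \<in> N" by (cases "i = 0"; cases "j = 0") (auto simp: row block col)
  qed
  then have "carrier (EL n) \<subseteq> N"
    using generate_subgroup_incl[OF _ sub] unfolding generate_EL(2)[symmetric] by blast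
  then show ?thesis using subgroup.subset[OF sub] by blast
qed

text \<open>Row 0 holds the involutions, so index \<open>j\<close> stands for column
  \<open>Suc j\<close>; \<open>m \<ge> 2\<close> supplies the third index for commutators.\<close>

lemma flipping_group_EL:
  assumes m: "m \<ge> 2"
  shows "flipping_group (EL (Suc m)) m
    (\<lambda>j. transvection 0 (Suc j) 0) (\<lambda>j k. transvection (Suc j) (Suc k) 0)"
proof -
  interpret group "EL (Suc m)" by (rule group_EL)
  have n: "Suc m \<ge> 3" using m by simp
  note mem = transvection_in_EL[OF n]
  show ?thesis
  proof
    show "N = carrier (EL (Suc m))"
      if N: "N \<lhd> EL (Suc m)" and t: "\<And>j. j < m \<Longrightarrow> transvection 0 (Suc j) 0 \<in> N" for N
    proof (rule normal_EL_eq_carrier[OF n N])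
      show "transvection 0 j 0 \<in> N" if "0 < j" "j < Suc m" for j
        using t[of "j - 1"] that by simp
    qed
  qed (simp_all add: mem mult_EL comp_EL one_EL transvection_involution transvection_commute_row
      transvection_commute_disjoint transvection_flip)
qed

section \<open>Choice of the matrix size and transport to the natural numbers\<close>

theorem theorem4p11:
  fixes \<epsilon> :: real
  assumes "\<epsilon> > 0"
  shows "\<exists>G :: nat monoid. group G \<and> infinite (carrier G) \<and> finitely_generated G \<and>
           residually_finite G \<and> alpha G < \<epsilon>"
proof -
  \<comment> \<open>Aiming at \<open>\<epsilon> / 2\<close> turns the weak bound of
    \<open>alpha_bound\<close> into a strict one.\<close>
  obtain m0 :: nat where m0: "m0 \<ge> 1 / (\<epsilon> / 2) ^ 3" using real_arch_simple by blast
  define m where "m = max m0 2"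
  have "m \<ge> 1 / (\<epsilon> / 2) ^ 3" using m0 by (simp add: m_def)
  then have m: "m \<ge> 2" "m * (\<epsilon> / 2) ^ 3 \<ge> 1"
    using assms by (simp_all add: m_def pos_divide_le_eq)
  interpret E: flipping_group "EL (Suc m)" m "\<lambda>j. transvection 0 (Suc j) 0"
      "\<lambda>j k. transvection (Suc j) (Suc k) 0"
    using flipping_group_EL[OF m(1)] .
  have "countable (carrier (EL (Suc m)))"
    using E.countable_generate[OF countable_finite[OF finite_transvections] generate_EL(1)]
    by (simp add: generate_EL(2))
  moreover have "infinite (carrier (EL (Suc m)))" using infinite_EL m by simp
  ultimately obtain G :: "nat monoid" and e d where G: "group G" "infinite (carrier G)"
    and e: "e \<in> hom (EL (Suc m)) G" "e ` carrier (EL (Suc m)) = carrier G"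
    and d: "d \<in> hom G (EL (Suc m))" "inj_on d (carrier G)"
    using E.nat_copy by blast
  interpret G: group G by (rule G)
  interpret e: group_hom "EL (Suc m)" G e
    by (simp add: group_hom_def group_hom_axioms_def e G E.is_group)
  interpret d: group_hom G "EL (Suc m)" d
    by (simp add: group_hom_def group_hom_axioms_def d G E.is_group)
  have "finitely_generated G"
    unfolding finitely_generated_def
  proof (intro exI conjI)
    show "finite (e ` transvections (Suc m))" by (simp add: finite_transvections)
    show "e ` transvections (Suc m) \<subseteq> carrier G" using generate_EL(1) e(2) by blast
    show "generate G (e ` transvections (Suc m)) = carrier G"
      using e.generate_img[OF generate_EL(1)] e(2) by (simp add: generate_EL(2))
  qed
  moreover have "residually_finite G"
  proof (rule G.residually_finite_if_finite_orbits[of d])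
    show "d \<one>\<^bsub>G\<^esub> = id" by (simp add: one_EL)
    show "d (a \<otimes>\<^bsub>G\<^esub> b) = d a \<circ> d b" if "a \<in> carrier G" "b \<in> carrier G" for a b
      using that by (simp add: mult_EL)
    show "a = \<one>\<^bsub>G\<^esub>" if "a \<in> carrier G" "d a = id" for a
      using inj_onD[OF d(2), of a "\<one>\<^bsub>G\<^esub>"] that by (simp add: one_EL)
    show "finite ((\<lambda>a. d a x) ` carrier G)" for x
      by (rule finite_subset[OF _ finite_orbit_EL[of x "Suc m"]]) auto
  qed
  moreover have "alpha G < \<epsilon>"
  proof -
    interpret F: flipping_group G m "\<lambda>j. e (transvection 0 (Suc j) 0)"
        "\<lambda>j k. e (transvection (Suc j) (Suc k) 0)"
      using E.flipping_group_image[OF G(1) e] .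
    have "alpha G \<le> \<epsilon> / 2" by (rule F.alpha_bound[OF _ m(2)]) (use assms in simp)
    then show ?thesis using assms by simp
  qed
  ultimately show ?thesis using G by blast
qed

end
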